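(* Under the change of variables $Q=Q_1Q_3$, $q=Q_2Q_3$, $y=Q_3$, the Donaldson-Thomas partition function of the banana manifold restricted to fiber classes, $$Z_{\mathrm{DT}}(X_{\text{ban}})_\Gamma=\prod_{d_1,d_2,d_3\ge0}\ \prod_{k\in\mathbb{Z}}\big(1-Q_1^{d_1}Q_2^{d_2}Q_3^{d_3}t^k\big)^{-12c(\|\underline{\mathbf d}\|,k)}\qquad(k\ge1\text{ if }d_1=d_2=d_3=0),$$ can be written as the formal Borcherds lift of $12\Phi_0$: $$Z_{\mathrm{DT}}(X_{\text{ban}})_\Gamma=\mathrm{BL}(12\Phi_0)=\prod_{(m,n,l,k)>0}\big(1-Q^mq^ny^lt^k\big)^{-12c(4nm-l^2,k)}.$$
   Context: **The product formula for $Z_{\mathrm{DT}}$.** $X_{\text{ban}}=\mathrm{Bl}_\Delta(S\times_{\mathbb{P}^1}S)$ is the banana manifold, where $S\to\mathbb{P}^1$ is a generic rational elliptic surface and $\Delta$ the diagonal; $\Gamma$ is the lattice of classes in $H_2(X_{\text{ban}},\mathbb{Z})$ supported in fibers of $X_{\text{ban}}\to\mathbb{P}^1$, generated by the three rational curves $C_1,C_2,C_3$ in a singular fiber (the three curves meet in two common points), and $Q_1,Q_2,Q_3$ track degrees along $C_1,C_2,C_3$. The displayed product for the generating function of Donaldson-Thomas invariants in fiber classes is a known theorem of J. Bryan and may be taken as the definition of $Z_{\mathrm{DT}}(X_{\text{ban}})_\Gamma$. The quadratic form is $$\|\underline{\mathbf d}\|=2d_1d_2+2d_1d_3+2d_2d_3-d_1^2-d_2^2-d_3^2.$$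 **Coefficients.** $\Phi_0$ is the equivariant elliptic genus of $\mathbb{C}^2$, $$\Phi_0=y^{-1}\prod_{n\ge1}\frac{(1-yq^{n-1}t)(1-y^{-1}q^nt^{-1})(1-yq^{n-1}t^{-1})(1-y^{-1}q^nt)}{(1-q^{n-1}t)(1-q^nt^{-1})(1-q^{n-1}t^{-1})(1-q^nt)},$$ expanded in the region $|q|<|t|<1$ as $\sum_{n\ge0}\sum_{l,k\in\mathbb{Z}}c(4n-l^2,k)q^ny^lt^k$ (the coefficient depends only on $4n-l^2$ and $k$, and vanishes when $4n-l^2<-1$). **Formal Borcherds lift.** With $q=e^{2\pi i\tau}$, $y=e^{2\pi iz}$, $t=e^{2\pi ix}$, for $m\ge1$ let $(\Phi_0|V_m)=\frac1m\sum_{ad=m,\,a>0}\sum_{b=0}^{d-1}\Phi_0(\frac{a\tau+b}{d},az,ax)$, and $(\Phi_0|V_0)=\sum_{(n,l,k)>0}c(-l^2,k)\,\mathrm{Li}_1(q^ny^lt^k)$, where $\mathrm{Li}_1(x)=-\log(1-x)$ and $(n,l,k)>0$ means $n>0$, or $n=0,l>0$, or $n=l=0,k>0$. Put $\mathrm{ML}(\Phi_0)=\sum_{m\ge0}Q^m(\Phi_0|V_m)$ and $\mathrm{BL}(\Phi_0)=\exp(\mathrm{ML}(\Phi_0))$; these definitions extend linearly, so $\mathrm{BL}(12\Phi_0)=\exp(12\,\mathrm{ML}(\Phi_0))$. **Index notation.** $(m,n,l,k)>0$, where $m,n\ge0$ and $l,k\in\mathbb{Z}$, means one of: (i) $m>0$;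 (ii) $m=0,\,n>0$; (iii) $m=n=0,\ l>0$; (iv) $m=n=l=0,\ k>0$. *)

theory Defs
  imports "HOL-Analysis.Analysis" "HOL-Computational_Algebra.Formal_Laurent_Series"
begin

section \<open>Formal series in Q, q, y, t\<close>

text \<open>
  The ambient ring is the iterated Laurent series field C((t))((y))((q))((Q)), the outermost
  variable being Q. A monomial Q^m q^n y^l t^k is "small" exactly if (m,n,l,k) > 0 in the
  lexicographic order, and \<open>inverse\<close> and \<open>powi\<close> with negative exponent expand
  in small monomials. The ring C((t))[[Q1,Q2,Q3]] embeds into this field by
  Q1 = Q/y, Q2 = q/y, Q3 = y.
\<close>

type_synonym series3 = "complex fls fls fls"
type_synonym series4 = "series3 fls"

definition var_t :: series4 where "var_t = fls_const (fls_const (fls_const fls_X))"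
definition var_y :: series4 where "var_y = fls_const (fls_const fls_X)"
definition var_q :: series4 where "var_q = fls_const fls_X"
definition var_Q :: series4 where "var_Q = fls_X"

definition coeff4 :: "series4 \<Rightarrow> int \<Rightarrow> int \<Rightarrow> int \<Rightarrow> int \<Rightarrow> complex" where
  "coeff4 f m n l k = fls_nth (fls_nth (fls_nth (fls_nth f m) n) l) k"

text \<open>
  Infinite sums and products converge formally if every coefficient is eventually constant along
  the finite partial sums (products), in any order. The library metric on iterated Laurent series
  is not used, since it is adic in the outermost variable only.
\<close>

definition has_formal_sum :: "('i \<Rightarrow> series4) \<Rightarrow> 'i set \<Rightarrow> series4 \<Rightarrow> bool" where
  "has_formal_sum f I S \<longleftrightarrow>
     (\<forall>m n l k. \<forall>\<^sub>F F in finite_subsets_at_top I. coeff4 (\<Sum>i\<in>F. f i) m n l k = coeff4 S m n l k)"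

definition formal_sum :: "('i \<Rightarrow> series4) \<Rightarrow> 'i set \<Rightarrow> series4" where
  "formal_sum f I = (THE S. has_formal_sum f I S)"

definition has_formal_prod :: "('i \<Rightarrow> series4) \<Rightarrow> 'i set \<Rightarrow> series4 \<Rightarrow> bool" where
  "has_formal_prod f I P \<longleftrightarrow>
     (\<forall>m n l k. \<forall>\<^sub>F F in finite_subsets_at_top I. coeff4 (\<Prod>i\<in>F. f i) m n l k = coeff4 P m n l k)"

definition formally_multipliable :: "('i \<Rightarrow> series4) \<Rightarrow> 'i set \<Rightarrow> bool" where
  "formally_multipliable f I \<longleftrightarrow> (\<exists>P. has_formal_prod f I P)"

definition formal_prod :: "('i \<Rightarrow> series4) \<Rightarrow> 'i set \<Rightarrow> series4" where
  "formal_prod f I = (THE P. has_formal_prod f I P)"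

definition formal_exp :: "series4 \<Rightarrow> series4" where
  "formal_exp f = formal_sum (\<lambda>j. f ^ j / fact j) (UNIV :: nat set)"

definition formal_Li1 :: "series4 \<Rightarrow> series4" where
  "formal_Li1 f = formal_sum (\<lambda>j. f ^ j / of_nat j) {1 :: nat..}"


section \<open>The elliptic genus and its coefficients\<close>

definition e2pi :: "complex \<Rightarrow> complex" where
  "e2pi w = exp (2 * of_real pi * \<i> * w)"

text \<open>The product index is shifted: the factor at \<open>n\<close> is the usual one at n + 1.\<close>

definition Phi0 :: "complex \<Rightarrow> complex \<Rightarrow> complex \<Rightarrow> complex" where
  "Phi0 \<tau> z x = (let q = e2pi \<tau>; y = e2pi z; t = e2pi x in
     inverse y * (\<Prod>n.
       ((1 - y * q ^ n * t) * (1 - inverse y * q ^ Suc n * inverse t) *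
        (1 - y * q ^ n * inverse t) * (1 - inverse y * q ^ Suc n * t)) /
       ((1 - q ^ n * t) * (1 - q ^ Suc n * inverse t) *
        (1 - q ^ n * inverse t) * (1 - q ^ Suc n * t))))"

text \<open>
  \<open>has_expansion N f a\<close>: on the region |q| < |t|^N, |t| < 1 the function \<open>f\<close> is the absolutely
  convergent sum of a(n,l,k) q^n y^l t^k over all integers n, l, k.
\<close>

definition has_expansion ::
  "nat \<Rightarrow> (complex \<Rightarrow> complex \<Rightarrow> complex \<Rightarrow> complex) \<Rightarrow> (int \<Rightarrow> int \<Rightarrow> int \<Rightarrow> complex) \<Rightarrow> bool" where
  "has_expansion N f a \<longleftrightarrow>
     (\<forall>\<tau> z x. norm (e2pi \<tau>) < norm (e2pi x) ^ N \<and> norm (e2pi x) < 1 \<longrightarrow>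
        ((\<lambda>(n, l, k). a n l k * (e2pi \<tau> powi n * e2pi z powi l * e2pi x powi k))
           has_sum f \<tau> z x) UNIV)"

text \<open>
  The coefficients c(D,k) of a function whose expansion coefficients c(4n - l^2, k) depend only on
  4n - l^2 and k. The first clause only fixes the value at those D that are not of the form
  4n - l^2, which never occur.
\<close>

definition jacobi_coeff :: "(complex \<Rightarrow> complex \<Rightarrow> complex \<Rightarrow> complex) \<Rightarrow> int \<Rightarrow> int \<Rightarrow> int" where
  "jacobi_coeff \<phi> = (THE c.
     (\<forall>D k. (\<nexists>n l. n \<ge> 0 \<and> D = 4 * n - l\<^sup>2) \<longrightarrow> c D k = 0) \<and>
     has_expansion 1 \<phi> (\<lambda>n l k. if n \<ge> 0 then of_int (c (4 * n - l\<^sup>2) k) else 0))"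


section \<open>The formal Borcherds lift\<close>

definition hecke_V ::
  "nat \<Rightarrow> (complex \<Rightarrow> complex \<Rightarrow> complex \<Rightarrow> complex) \<Rightarrow> complex \<Rightarrow> complex \<Rightarrow> complex \<Rightarrow> complex" where
  "hecke_V m \<phi> \<tau> z x =
     (1 / of_nat m) * (\<Sum>(a, d)\<in>{(a, d). a * d = m \<and> a > 0}. \<Sum>b<d.
        \<phi> ((of_nat a * \<tau> + of_nat b) / of_nat d) (of_nat a * z) (of_nat a * x))"

text \<open>
  The expansion of \<open>hecke_V m \<phi>\<close> lives on |q| < |t|^m: the arguments of \<open>\<phi>\<close> lie in the region of
  expansion of \<open>\<phi>\<close> if |q| < |t|^d for all divisors d of m.
\<close>

definition formal_V ::
  "(complex \<Rightarrow> complex \<Rightarrow> complex \<Rightarrow> complex) \<Rightarrow> nat \<Rightarrow> series4" where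
  "formal_V \<phi> m =
     (if m = 0 then
        formal_sum
          (\<lambda>(n, l, k). of_int (jacobi_coeff \<phi> (- (l\<^sup>2)) k) *
                       formal_Li1 (var_q ^ n * var_y powi l * var_t powi k))
          {(n :: nat, l :: int, k :: int). n > 0 \<or> n = 0 \<and> l > 0 \<or> n = 0 \<and> l = 0 \<and> k > 0}
      else
        fls_const (THE h :: series3. has_expansion m (hecke_V m \<phi>) (\<lambda>n l k. fls_nth (fls_nth (fls_nth h n) l) k)))"

definition formal_ML :: "(complex \<Rightarrow> complex \<Rightarrow> complex \<Rightarrow> complex) \<Rightarrow> series4" where
  "formal_ML \<phi> = formal_sum (\<lambda>m. var_Q ^ m * formal_V \<phi> m) UNIV"

text \<open>\<open>formal_BL r \<phi>\<close> is BL(r \<phi>), with ML extended linearly.\<close>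

definition formal_BL :: "nat \<Rightarrow> (complex \<Rightarrow> complex \<Rightarrow> complex \<Rightarrow> complex) \<Rightarrow> series4" where
  "formal_BL r \<phi> = formal_exp (of_nat r * formal_ML \<phi>)"

definition BL_index :: "(nat \<times> nat \<times> int \<times> int) set" where
  "BL_index = {(m, n, l, k). m > 0 \<or> m = 0 \<and> n > 0 \<or> m = 0 \<and> n = 0 \<and> l > 0 \<or>
                             m = 0 \<and> n = 0 \<and> l = 0 \<and> k > 0}"

definition BL_factor :: "nat \<times> nat \<times> int \<times> int \<Rightarrow> series4" where
  "BL_factor = (\<lambda>(m, n, l, k).
     (1 - var_Q ^ m * var_q ^ n * var_y powi l * var_t powi k)
       powi (- 12 * jacobi_coeff Phi0 (4 * int n * int m - l\<^sup>2) k))"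


section \<open>The Donaldson--Thomas partition function in fiber classes\<close>

definition banana_form :: "nat \<Rightarrow> nat \<Rightarrow> nat \<Rightarrow> int" where
  "banana_form d1 d2 d3 =
     2 * int d1 * int d2 + 2 * int d1 * int d3 + 2 * int d2 * int d3
       - (int d1)\<^sup>2 - (int d2)\<^sup>2 - (int d3)\<^sup>2"

definition DT_index :: "(nat \<times> nat \<times> nat \<times> int) set" where
  "DT_index = {(d1, d2, d3, k). d1 = 0 \<and> d2 = 0 \<and> d3 = 0 \<longrightarrow> k \<ge> 1}"

definition DT_factor ::
  "series4 \<Rightarrow> series4 \<Rightarrow> series4 \<Rightarrow> nat \<times> nat \<times> nat \<times> int \<Rightarrow> series4" where
  "DT_factor Q1 Q2 Q3 = (\<lambda>(d1, d2, d3, k).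
     (1 - Q1 ^ d1 * Q2 ^ d2 * Q3 ^ d3 * var_t powi k)
       powi (- 12 * jacobi_coeff Phi0 (banana_form d1 d2 d3) k))"

text \<open>
  By Bryan's theorem this product is the generating function of the Donaldson--Thomas invariants
  of the banana manifold in fiber classes; here it serves as the definition.
\<close>

definition Z_DT_banana :: "series4 \<Rightarrow> series4 \<Rightarrow> series4 \<Rightarrow> series4" where
  "Z_DT_banana Q1 Q2 Q3 = formal_prod (DT_factor Q1 Q2 Q3) DT_index"

end

theory Submission
  imports Defs
begin

text \<open>
  Put m = d1, n = d2 and l = d3 - d1 - d2. Then Q1^d1 Q2^d2 Q3^d3 = Q^m q^n y^l, and the form
  ||d|| is the discriminant 4nm - l^2. So the Donaldson--Thomas product is the part of the
  Borcherds product with l \<ge> -(m + n). The remaining factors have discriminant below -1, where the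
  coefficients of the elliptic genus vanish, and are therefore equal to 1
  (\<open>BL_factor_outside_banana\<close>).

  To compare the Borcherds product with exp(12 ML), take logarithms: minus the logarithm of
  1 - x is Li1(x), and in the sum of all c(4nm - l^2, k) Li1(Q^m q^n y^l t^k) the monomial with
  exponent v gets the coefficient given by the sum of c(v/a)/a over the common divisors a of v
  (\<open>coeff4_log_BL\<close>). For m > 0 this is the Fourier coefficient of the Hecke operator V_m
  (\<open>has_expansion_hecke_V\<close>): averaging over b keeps the q-exponents divisible by d. For m = 0 it is
  the definition of V_0. So the sum is ML (\<open>formal_ML_eq_log_BL\<close>), and it remains to see that the
  formal exponential turns this infinite sum into an infinite product.

  For this, all series are confined to a cone of exponents. If c(4nm - l^2, k) is not 0 then
  k \<ge> -nm and l^2 \<le> 4nm + 1, so that l \<ge> -(m + n) unless m = n = 0. The set of all (m, n, l, k) with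
  m, n \<ge> 0, l \<ge> -(m + n) and k \<ge> -nm is closed under addition, and the weight
  2m + 2n + l + k + nm is superadditive on it, takes each value finitely often, and is at least 1
  on the monomials of the product. Series supported in the cone thus form a ring that is
  complete for the filtration by weight; there the exponential converges, is multiplicative and
  is continuous (\<open>has_formal_prod_formal_exp\<close>).

  The facts about c come from analysis. After the factors 1 - y/t and 1 - 1/t are split
  off, the elliptic genus is a product of factors 1 - u q^n and their inverses; multiplying out
  gives an absolutely convergent family of monomials with integer coefficients, supported in
  n \<ge> 0 and n + k \<ge> 0 (\<open>integral_expansion_Phi0\<close>). Coefficients of such expansions are unique
  (\<open>has_expansion_unique\<close>), so the transformation law under z \<mapsto> z + \<tau> (\<open>Phi0_elliptic_shift\<close>)
  becomes a recursion for the coefficients, by which they depend on 4n - l^2 and k only. Moving l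
  to 0 or 1 and using n \<ge> 0 there shows that c vanishes below discriminant -1.
\<close>

section \<open>Series supported in a cone of exponents\<close>

text \<open>
  The bound on k is quadratic because the coefficient c(4nm - l^2, k) can be nonzero for k down to
  -nm. No linear functional is positive on all these exponents; the extra term m * n in the weight
  compensates for this, at the price of superadditivity in place of additivity.
\<close>

definition in_cone :: "int \<Rightarrow> int \<Rightarrow> int \<Rightarrow> int \<Rightarrow> bool" where
  "in_cone m n l k \<longleftrightarrow> 0 \<le> m \<and> 0 \<le> n \<and> 0 \<le> l + m + n \<and> 0 \<le> k + m * n"

definition weight :: "int \<Rightarrow> int \<Rightarrow> int \<Rightarrow> int \<Rightarrow> int" where
  "weight m n l k = 2 * m + 2 * n + l + k + m * n"

text \<open>
  The filtration by weight. Order at least 0 means support in the cone.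
\<close>

definition ord_ge :: "nat \<Rightarrow> series4 \<Rightarrow> bool" where
  "ord_ge N f \<longleftrightarrow>
     (\<forall>m n l k. coeff4 f m n l k \<noteq> 0 \<longrightarrow> in_cone m n l k \<and> int N \<le> weight m n l k)"

lemma in_cone_add:
  assumes "in_cone m n l k" "in_cone m' n' l' k'"
  shows "in_cone (m + m') (n + n') (l + l') (k + k')"
proof -
  have "0 \<le> m * n'" "0 \<le> m' * n"
    using assms by (auto simp: in_cone_def)
  moreover have "0 \<le> k + m * n" "0 \<le> k' + m' * n'"
    using assms by (auto simp: in_cone_def)
  moreover have "(m + m') * (n + n') = m * n + m' * n' + m * n' + m' * n"
    by (simp add: algebra_simps)
  ultimately have "0 \<le> (k + k') + (m + m') * (n + n')" by linarith
  thus ?thesis using assms by (auto simp: in_cone_def)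
qed

lemma weight_add:
  assumes "in_cone m n l k" "in_cone m' n' l' k'"
  shows "weight m n l k + weight m' n' l' k' \<le> weight (m + m') (n + n') (l + l') (k + k')"
proof -
  have "0 \<le> m * n'" "0 \<le> m' * n"
    using assms by (auto simp: in_cone_def)
  thus ?thesis by (auto simp: weight_def algebra_simps)
qed

lemma finite_cone_weight:
  "finite {(m, n, l, k). in_cone m n l k \<and> weight m n l k \<le> N}"
proof (rule finite_subset)
  have "(m, n, l, k) \<in> {0..N} \<times> {0..N} \<times> {-2*N..N} \<times> {-(N*N)..N}"
    if *: "in_cone m n l k" "weight m n l k \<le> N" for m n l k
  proof -
    have c: "0 \<le> m" "0 \<le> n" "0 \<le> l + m + n" "0 \<le> k + m * n"
       and w: "m + n + (l + m + n) + (k + m * n) \<le> N"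
      using * by (auto simp: in_cone_def weight_def)
    have mn: "m * n \<le> N * N" "0 \<le> m * n"
      using c w by (auto intro!: mult_mono)
    have "m \<in> {0..N}" "n \<in> {0..N}" "l \<in> {-2*N..N}" "k \<in> {-(N*N)..N}"
      using c w mn unfolding atLeastAtMost_iff by linarith+
    thus ?thesis by blast
  qed
  thus "{(m, n, l, k). in_cone m n l k \<and> weight m n l k \<le> N} \<subseteq>
          {0..N} \<times> {0..N} \<times> {-2*N..N} \<times> {-(N*N)..N}"
    by auto
qed auto

lemma series4_eqI:
  assumes "\<And>m n l k. coeff4 f m n l k = coeff4 g m n l k"
  shows "f = g"
  using assms by (auto simp: coeff4_def intro!: fls_eqI)

lemma coeff4_0 [simp]: "coeff4 0 m n l k = 0"
  by (simp add: coeff4_def)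

lemma coeff4_add: "coeff4 (f + g) m n l k = coeff4 f m n l k + coeff4 g m n l k"
  by (simp add: coeff4_def)

lemma coeff4_diff: "coeff4 (f - g) m n l k = coeff4 f m n l k - coeff4 g m n l k"
  by (simp add: coeff4_def)

lemma coeff4_sum: "coeff4 (\<Sum>i\<in>F. f i) m n l k = (\<Sum>i\<in>F. coeff4 (f i) m n l k)"
  by (simp add: coeff4_def fls_nth_sum)

text \<open>
  The additive map \<open>\<phi>\<close> reads off a coefficient further inside; applying the lemma once per variable
  unfolds a product of iterated series.
\<close>

lemma fls_mult_nth_nonzeroE:
  fixes \<phi> :: "'a :: comm_ring_1 \<Rightarrow> 'b :: comm_monoid_add"
  assumes "\<phi> (fls_nth (f * g) m) \<noteq> 0"
    and "\<And>(h :: int \<Rightarrow> 'a) A. \<phi> (\<Sum>i\<in>A. h i) = (\<Sum>i\<in>A. \<phi> (h i))"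
  obtains i where "\<phi> (fls_nth f i * fls_nth g (m - i)) \<noteq> 0"
  using assms(1) unfolding fls_times_nth(2) assms(2) by (meson sum.not_neutral_contains_not_neutral)

lemma coeff4_mult_nonzeroE:
  assumes "coeff4 (f * g) m n l k \<noteq> 0"
  obtains m' n' l' k' where "coeff4 f m' n' l' k' \<noteq> 0"
    "coeff4 g (m - m') (n - n') (l - l') (k - k') \<noteq> 0"
proof -
  obtain m' where 1: "fls_nth (fls_nth (fls_nth (fls_nth f m' * fls_nth g (m - m')) n) l) k \<noteq> 0"
    by (rule fls_mult_nth_nonzeroE[where \<phi> = "\<lambda>h. fls_nth (fls_nth (fls_nth h n) l) k",
          OF assms[unfolded coeff4_def]]) (auto simp: fls_nth_sum)
  obtain n' where 2: "fls_nth (fls_nth (fls_nth (fls_nth f m') n' *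
      fls_nth (fls_nth g (m - m')) (n - n')) l) k \<noteq> 0"
    by (rule fls_mult_nth_nonzeroE[where \<phi> = "\<lambda>h. fls_nth (fls_nth h l) k", OF 1])
       (auto simp: fls_nth_sum)
  obtain l' where 3: "fls_nth (fls_nth (fls_nth (fls_nth f m') n') l' *
      fls_nth (fls_nth (fls_nth g (m - m')) (n - n')) (l - l')) k \<noteq> 0"
    by (rule fls_mult_nth_nonzeroE[where \<phi> = "\<lambda>h. fls_nth h k", OF 2]) (auto simp: fls_nth_sum)
  obtain k' where 4: "fls_nth (fls_nth (fls_nth (fls_nth f m') n') l') k' *
      fls_nth (fls_nth (fls_nth (fls_nth g (m - m')) (n - n')) (l - l')) (k - k') \<noteq> 0"
    by (rule fls_mult_nth_nonzeroE[where \<phi> = "\<lambda>h. h", OF 3]) auto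
  show ?thesis by (rule that[of m' n' l' k']) (use 4 in \<open>auto simp: coeff4_def\<close>)
qed

lemma ord_geD:
  assumes "ord_ge N f" "coeff4 f m n l k \<noteq> 0"
  shows "in_cone m n l k" "int N \<le> weight m n l k"
  using assms by (auto simp: ord_ge_def)

lemma ord_ge_mono: "ord_ge M f \<Longrightarrow> N \<le> M \<Longrightarrow> ord_ge N f"
  unfolding ord_ge_def by (meson of_nat_mono order.trans)

lemma ord_ge_0_imp: "ord_ge N f \<Longrightarrow> ord_ge 0 f"
  by (rule ord_ge_mono) auto

lemma ord_ge_zero [simp]: "ord_ge N 0"
  by (auto simp: ord_ge_def)

lemma ord_ge_add: "ord_ge N f \<Longrightarrow> ord_ge N g \<Longrightarrow> ord_ge N (f + g)"
  by (simp add: ord_ge_def coeff4_add) (metis add_0)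

lemma ord_ge_diff: "ord_ge N f \<Longrightarrow> ord_ge N g \<Longrightarrow> ord_ge N (f - g)"
  by (simp add: ord_ge_def coeff4_diff) (metis diff_0_right)

lemma ord_ge_sum: "(\<And>i. i \<in> F \<Longrightarrow> ord_ge N (f i)) \<Longrightarrow> ord_ge N (\<Sum>i\<in>F. f i)"
  by (induction F rule: infinite_finite_induct) (auto intro: ord_ge_add)

lemma ord_ge_mult:
  assumes "ord_ge M f" "ord_ge N g"
  shows "ord_ge (M + N) (f * g)"
  unfolding ord_ge_def
proof (intro allI impI)
  fix m n l k assume "coeff4 (f * g) m n l k \<noteq> 0"
  then obtain m' n' l' k' where *: "coeff4 f m' n' l' k' \<noteq> 0"
    "coeff4 g (m - m') (n - n') (l - l') (k - k') \<noteq> 0"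
    by (rule coeff4_mult_nonzeroE)
  show "in_cone m n l k \<and> int (M + N) \<le> weight m n l k"
    using in_cone_add[OF ord_geD(1)[OF assms(1) *(1)] ord_geD(1)[OF assms(2) *(2)]]
      weight_add[OF ord_geD(1)[OF assms(1) *(1)] ord_geD(1)[OF assms(2) *(2)]]
      ord_geD(2)[OF assms(1) *(1)] ord_geD(2)[OF assms(2) *(2)]
    by simp
qed

definition const4 :: "complex \<Rightarrow> series4" where
  "const4 c = fls_const (fls_const (fls_const (fls_const c)))"

lemma coeff4_const4: "coeff4 (const4 c) m n l k = (if m = 0 \<and> n = 0 \<and> l = 0 \<and> k = 0 then c else 0)"
  by (auto simp: const4_def coeff4_def)

lemma coeff4_const4_mult: "coeff4 (const4 c * f) m n l k = c * coeff4 f m n l k"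
  by (simp add: const4_def coeff4_def)

lemma const4_1 [simp]: "const4 1 = 1" and const4_0 [simp]: "const4 0 = 0"
  by (simp_all add: const4_def)

lemma const4_mult: "const4 (a * b) = const4 a * const4 b"
  by (simp add: const4_def)

lemma const4_add: "const4 (a + b) = const4 a + const4 b"
  by (simp add: const4_def fls_plus_const)

lemma const4_minus_1: "const4 (- 1) = - 1"
  using const4_add[of "- 1" 1] by (simp add: eq_neg_iff_add_eq_0)

lemma const4_inverse: "const4 (inverse a) = inverse (const4 a)"
proof (cases "a = 0")
  case False
  have "const4 a * const4 (inverse a) = 1" using False by (simp flip: const4_mult)
  thus ?thesis by (metis inverse_unique)
qed simp

lemma of_nat_eq_const4: "of_nat n = const4 (of_nat n)"
  by (simp add: const4_def fls_of_nat)

lemma of_int_eq_const4: "of_int n = const4 (of_int n)"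
  by (simp add: const4_def fls_of_int)

lemma divide_of_nat_eq: "f / of_nat n = const4 (inverse (of_nat n)) * f"
  by (simp add: of_nat_eq_const4 const4_inverse divide_inverse mult.commute del: const4_0)

lemma divide_fact_eq: "f / fact n = const4 (inverse (fact n)) * f"
  using divide_of_nat_eq[of f "fact n"] by simp

lemma ord_ge_const4_mult: "ord_ge N f \<Longrightarrow> ord_ge N (const4 c * f)"
  by (auto simp: ord_ge_def coeff4_const4_mult)

lemma ord_ge_one [simp]: "ord_ge 0 1"
  using coeff4_const4[of 1] by (auto simp: ord_ge_def in_cone_def weight_def split: if_splits)

lemma ord_ge_power: "ord_ge N f \<Longrightarrow> ord_ge (N * j) (f ^ j)"
  by (induction j) (auto dest: ord_ge_mult)

lemma ord_ge_power1: "ord_ge 1 f \<Longrightarrow> ord_ge j (f ^ j)"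
  using ord_ge_power[of 1 f j] by simp

text \<open>
  The filtration is separated: a nonzero coefficient has a finite weight.
\<close>

lemma ord_ge_eqI:
  assumes "\<And>N. ord_ge N (f - g)"
  shows "f = g"
proof (rule series4_eqI, rule ccontr)
  fix m n l k assume *: "coeff4 f m n l k \<noteq> coeff4 g m n l k"
  have "coeff4 (f - g) m n l k \<noteq> 0"
    using * by (simp add: coeff4_diff)
  from ord_geD(2)[OF assms this, of "nat (weight m n l k + 1)"] show False
    by linarith
qed

lemma ord_ge_coeff_eq:
  assumes "ord_ge N (f - g)" "weight m n l k < int N"
  shows "coeff4 f m n l k = coeff4 g m n l k"
  using ord_geD(2)[OF assms(1), of m n l k] assms(2) by (force simp: coeff4_diff)

lemma ord_ge_trans: "ord_ge N (f - g) \<Longrightarrow> ord_ge N (g - h) \<Longrightarrow> ord_ge N (f - h)"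
  using ord_ge_add[of N "f - g" "g - h"] by simp

lemma ord_ge_commute: "ord_ge N (f - g) \<Longrightarrow> ord_ge N (g - f)"
  using ord_ge_diff[of N 0 "f - g"] by simp

lemma ord_ge_diff_imp_0: "ord_ge N (f - g) \<Longrightarrow> ord_ge 0 g \<Longrightarrow> ord_ge 0 f"
  using ord_ge_add[of 0 "f - g" g] ord_ge_0_imp by simp

lemma ord_ge_mult_cong:
  assumes "ord_ge N (a - a')" "ord_ge N (b - b')" "ord_ge 0 a" "ord_ge 0 b'"
  shows "ord_ge N (a * b - a' * b')"
proof -
  have "a * b - a' * b' = a * (b - b') + (a - a') * b'"
    by (simp add: algebra_simps)
  thus ?thesis
    using ord_ge_add[of N "a * (b - b')" "(a - a') * b'"]
      ord_ge_mult[OF assms(3,2)] ord_ge_mult[OF assms(1,4)] by simp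
qed

subsection \<open>Adic sums\<close>

definition series4_of :: "(int \<Rightarrow> int \<Rightarrow> int \<Rightarrow> int \<Rightarrow> complex) \<Rightarrow> series4" where
  "series4_of c = Abs_fls (\<lambda>m. Abs_fls (\<lambda>n. Abs_fls (\<lambda>l. Abs_fls (\<lambda>k. c m n l k))))"

lemma coeff4_series4_of:
  assumes "\<And>m n l k. c m n l k \<noteq> 0 \<Longrightarrow> in_cone m n l k"
  shows "coeff4 (series4_of c) m n l k = c m n l k"
proof -
  have 0: "c m n l k = 0" if "\<not> in_cone m n l k" for m n l k
    using assms that by blast
  have nthk: "fls_nth (Abs_fls (\<lambda>k. c m n l k)) k = c m n l k" for m n l k
    by (rule nth_Abs_fls_lower_bound[of "- (m * n)"]) (auto intro!: 0 simp: in_cone_def)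
  have z1: "Abs_fls (\<lambda>k. c m n l k) = 0" if "m < 0 \<or> n < 0 \<or> l < - (m + n)" for m n l
    by (rule fls_eqI, unfold nthk) (use that in \<open>auto intro!: 0 simp: in_cone_def\<close>)
  have nthl: "fls_nth (Abs_fls (\<lambda>l. Abs_fls (\<lambda>k. c m n l k))) l = Abs_fls (\<lambda>k. c m n l k)" for m n l
    by (rule nth_Abs_fls_lower_bound[of "- (m + n)"]) (auto intro!: z1)
  have z2: "Abs_fls (\<lambda>l. Abs_fls (\<lambda>k. c m n l k)) = 0" if "m < 0 \<or> n < 0" for m n
    by (rule fls_eqI, unfold nthl) (use that in \<open>auto intro!: z1\<close>)
  have nthn: "fls_nth (Abs_fls (\<lambda>n. Abs_fls (\<lambda>l. Abs_fls (\<lambda>k. c m n l k)))) n =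
                Abs_fls (\<lambda>l. Abs_fls (\<lambda>k. c m n l k))" for m n
    by (rule nth_Abs_fls_lower_bound[of 0]) (auto intro!: z2)
  have z3: "Abs_fls (\<lambda>n. Abs_fls (\<lambda>l. Abs_fls (\<lambda>k. c m n l k))) = 0" if "m < 0" for m
    by (rule fls_eqI, unfold nthn) (use that in \<open>auto intro!: z2\<close>)
  have nthm: "fls_nth (series4_of c) m = Abs_fls (\<lambda>n. Abs_fls (\<lambda>l. Abs_fls (\<lambda>k. c m n l k)))" for m
    unfolding series4_of_def by (rule nth_Abs_fls_lower_bound[of 0]) (auto intro!: z3)
  show ?thesis
    by (simp add: coeff4_def nthm nthn nthl nthk)
qed

text \<open>
  A family that tends to 0 in the filtration. Each coefficient of its sum is then a finite sum.
\<close>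

definition adic_family :: "('i \<Rightarrow> series4) \<Rightarrow> 'i set \<Rightarrow> bool" where
  "adic_family g I \<longleftrightarrow> (\<forall>i\<in>I. ord_ge 0 (g i)) \<and> (\<forall>N. finite {i\<in>I. \<not> ord_ge N (g i)})"

definition adic_sum :: "('i \<Rightarrow> series4) \<Rightarrow> 'i set \<Rightarrow> series4" where
  "adic_sum g I = series4_of (\<lambda>m n l k.
     \<Sum>i | i \<in> I \<and> coeff4 (g i) m n l k \<noteq> 0. coeff4 (g i) m n l k)"

lemma adic_family_finite_coeff:
  assumes "adic_family g I"
  shows "finite {i \<in> I. coeff4 (g i) m n l k \<noteq> 0}"
proof (rule finite_subset)
  show "finite {i\<in>I. \<not> ord_ge (nat (weight m n l k + 1)) (g i)}"
    using assms by (auto simp: adic_family_def)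
  show "{i \<in> I. coeff4 (g i) m n l k \<noteq> 0} \<subseteq> {i\<in>I. \<not> ord_ge (nat (weight m n l k + 1)) (g i)}"
    by (safe, drule (1) ord_geD(2), linarith)
qed

lemma coeff4_adic_sum:
  assumes "adic_family g I"
  shows "coeff4 (adic_sum g I) m n l k =
           (\<Sum>i | i \<in> I \<and> coeff4 (g i) m n l k \<noteq> 0. coeff4 (g i) m n l k)"
  unfolding adic_sum_def
proof (rule coeff4_series4_of)
  fix m n l k
  assume "(\<Sum>i | i \<in> I \<and> coeff4 (g i) m n l k \<noteq> 0. coeff4 (g i) m n l k) \<noteq> 0"
  then obtain i where "i \<in> I" "coeff4 (g i) m n l k \<noteq> 0"
    by (auto elim: sum.not_neutral_contains_not_neutral)
  thus "in_cone m n l k" using assms ord_geD(1) by (auto simp: adic_family_def)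
qed

text \<open>
  A term that contributes in weight below N does not have order at least N, so it belongs to F.
\<close>

lemma adic_sum_approx:
  assumes "adic_family g I" "finite F" "F \<subseteq> I" "{i\<in>I. \<not> ord_ge N (g i)} \<subseteq> F"
  shows "ord_ge N (adic_sum g I - sum g F)"
  unfolding ord_ge_def
proof (intro allI impI, rule ccontr)
  fix m n l k
  assume nz: "coeff4 (adic_sum g I - sum g F) m n l k \<noteq> 0"
     and not: "\<not> (in_cone m n l k \<and> int N \<le> weight m n l k)"
  let ?A = "{i \<in> I. coeff4 (g i) m n l k \<noteq> 0}"
  have "?A \<subseteq> F"
  proof
    fix i assume i: "i \<in> ?A"
    have "ord_ge 0 (g i)" using i assms(1) by (auto simp: adic_family_def)
    hence "in_cone m n l k" using i ord_geD(1) by blast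
    with not have "\<not> ord_ge N (g i)" using i ord_geD(2) by blast
    thus "i \<in> F" using assms(4) i by auto
  qed
  hence "(\<Sum>i\<in>F. coeff4 (g i) m n l k) = (\<Sum>i\<in>?A. coeff4 (g i) m n l k)"
    using assms(2,3) by (intro sum.mono_neutral_right) auto
  with nz show False
    by (simp add: coeff4_diff coeff4_adic_sum[OF assms(1)] coeff4_sum)
qed

lemma adic_sum_approx':
  assumes "adic_family g I"
  shows "ord_ge N (adic_sum g I - sum g {i\<in>I. \<not> ord_ge N (g i)})"
  using assms by (intro adic_sum_approx) (auto simp: adic_family_def)

lemma ord_ge_adic_sum:
  assumes "adic_family g I" "\<And>i. i \<in> I \<Longrightarrow> ord_ge N (g i)"
  shows "ord_ge N (adic_sum g I)"
proof -
  have *: "{i \<in> I. \<not> ord_ge N (g i)} = {}" using assms by auto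
  show ?thesis using adic_sum_approx'[OF assms(1), of N] unfolding * by simp
qed

lemma has_formal_sum_adic_sum:
  assumes "adic_family g I"
  shows "has_formal_sum g I (adic_sum g I)"
  unfolding has_formal_sum_def
proof (intro allI)
  fix m n l k
  let ?A = "{i \<in> I. coeff4 (g i) m n l k \<noteq> 0}"
  have fin: "finite ?A" by (rule adic_family_finite_coeff[OF assms])
  show "\<forall>\<^sub>F F in finite_subsets_at_top I.
          coeff4 (sum g F) m n l k = coeff4 (adic_sum g I) m n l k"
    unfolding eventually_finite_subsets_at_top
  proof (intro exI[of _ ?A] conjI allI impI)
    fix F assume F: "finite F \<and> ?A \<subseteq> F \<and> F \<subseteq> I"
    hence "(\<Sum>i\<in>F. coeff4 (g i) m n l k) = (\<Sum>i\<in>?A. coeff4 (g i) m n l k)"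
      by (intro sum.mono_neutral_right) auto
    thus "coeff4 (sum g F) m n l k = coeff4 (adic_sum g I) m n l k"
      by (simp add: coeff4_adic_sum[OF assms] coeff4_sum)
  qed (use fin in auto)
qed

lemma has_formal_sum_unique:
  assumes "has_formal_sum f I S" "has_formal_sum f I S'"
  shows "S = S'"
proof (rule series4_eqI)
  fix m n l k
  have "\<forall>\<^sub>F F in finite_subsets_at_top I. coeff4 S m n l k = coeff4 S' m n l k"
    using assms(1)[unfolded has_formal_sum_def, rule_format, of m n l k]
      assms(2)[unfolded has_formal_sum_def, rule_format, of m n l k]
    by eventually_elim simp
  thus "coeff4 S m n l k = coeff4 S' m n l k" by simp
qed

lemma formal_sum_eqI: "has_formal_sum f I S \<Longrightarrow> formal_sum f I = S"
  unfolding formal_sum_def using has_formal_sum_unique by blast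

lemma has_formal_prod_unique:
  assumes "has_formal_prod f I S" "has_formal_prod f I S'"
  shows "S = S'"
proof (rule series4_eqI)
  fix m n l k
  have "\<forall>\<^sub>F F in finite_subsets_at_top I. coeff4 S m n l k = coeff4 S' m n l k"
    using assms(1)[unfolded has_formal_prod_def, rule_format, of m n l k]
      assms(2)[unfolded has_formal_prod_def, rule_format, of m n l k]
    by eventually_elim simp
  thus "coeff4 S m n l k = coeff4 S' m n l k" by simp
qed

lemma formal_prod_eqI: "has_formal_prod f I S \<Longrightarrow> formal_prod f I = S"
  unfolding formal_prod_def using has_formal_prod_unique by blast

lemma formal_sum_adic: "adic_family g I \<Longrightarrow> formal_sum g I = adic_sum g I"
  by (intro formal_sum_eqI has_formal_sum_adic_sum)

lemma adic_family_seq: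
  assumes "\<And>j. ord_ge j (g j)"
  shows "adic_family g (I :: nat set)"
  unfolding adic_family_def
proof (intro conjI ballI allI)
  show "ord_ge 0 (g i)" for i using assms ord_ge_0_imp by blast
  fix N show "finite {i \<in> I. \<not> ord_ge N (g i)}"
    by (rule finite_subset[of _ "{..<N}"]) (auto intro: ord_ge_mono[OF assms] leI ccontr)
qed

lemma adic_sum_seq_approx:
  assumes "\<And>j. ord_ge j (g j)"
  shows "ord_ge N (adic_sum g (UNIV :: nat set) - (\<Sum>j<N. g j))"
  by (rule adic_sum_approx)
     (auto intro!: adic_family_seq assms intro: ord_ge_mono[OF assms] leI ccontr)

text \<open>
  Modulo weight N only the partial sums below N matter, and in their product the terms with
  i + j \<ge> N have order at least N. This one statement yields both the addition theorem of the
  exponential and the multiplicativity of the evaluation of power series.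
\<close>

lemma adic_sum_Cauchy_product:
  assumes a: "\<And>j. ord_ge j (a j)" and b: "\<And>j. ord_ge j (b j)"
  shows "adic_sum a UNIV * adic_sum b UNIV = adic_sum (\<lambda>n. \<Sum>i\<le>n. a i * b (n - i)) UNIV"
proof (rule ord_ge_eqI)
  fix N
  let ?A = "adic_sum a UNIV" and ?B = "adic_sum b UNIV"
  let ?c = "\<lambda>n. \<Sum>i\<le>n. a i * b (n - i)"
  have ab: "ord_ge (i + j) (a i * b j)" for i j
    by (intro ord_ge_mult a b)
  have c: "ord_ge n (?c n)" for n
    by (rule ord_ge_sum) (use ab in \<open>metis atMost_iff le_add_diff_inverse\<close>)
  have 0: "ord_ge 0 (sum f F)" if "\<And>j. ord_ge j (f j)" for f and F :: "nat set"
    by (rule ord_ge_sum) (use that ord_ge_0_imp in blast)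
  have 1: "ord_ge N (?A * ?B - (\<Sum>j<N. a j) * (\<Sum>j<N. b j))"
    by (intro ord_ge_mult_cong adic_sum_seq_approx a b 0 ord_ge_adic_sum adic_family_seq
          ord_ge_0_imp[OF a])
  have "(\<Sum>j<N. a j) * (\<Sum>j<N. b j) = (\<Sum>(i, j)\<in>{..<N} \<times> {..<N}. a i * b j)"
    by (simp add: sum_product sum.cartesian_product)
  also have "\<dots> = (\<Sum>(i, j)\<in>{(i, j). i + j < N}. a i * b j) +
      (\<Sum>(i, j)\<in>{..<N} \<times> {..<N} - {(i, j). i + j < N}. a i * b j)"
    by (subst sum.subset_diff[of "{(i, j). i + j < N}"]) (auto simp: add.commute)
  also have "(\<Sum>(i, j)\<in>{(i, j). i + j < N}. a i * b j) = (\<Sum>n<N. ?c n)"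
    by (rule sum.triangle_reindex)
  finally have "(\<Sum>j<N. a j) * (\<Sum>j<N. b j) - (\<Sum>n<N. ?c n) =
      (\<Sum>(i, j)\<in>{..<N} \<times> {..<N} - {(i, j). i + j < N}. a i * b j)"
    by simp
  moreover have "ord_ge N (\<Sum>(i, j)\<in>{..<N} \<times> {..<N} - {(i, j). i + j < N}. a i * b j)"
    by (rule ord_ge_sum) (auto intro: ord_ge_mono[OF ab])
  ultimately have 2: "ord_ge N ((\<Sum>j<N. a j) * (\<Sum>j<N. b j) - (\<Sum>n<N. ?c n))"
    by simp
  have 3: "ord_ge N ((\<Sum>n<N. ?c n) - adic_sum ?c UNIV)"
    by (rule ord_ge_commute, rule adic_sum_seq_approx) (rule c)
  show "ord_ge N (?A * ?B - adic_sum ?c UNIV)"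
    by (rule ord_ge_trans[OF ord_ge_trans[OF 1 2] 3])
qed

subsection \<open>The exponential\<close>

lemma ord_ge_exp_term: "ord_ge 1 f \<Longrightarrow> ord_ge j (f ^ j / fact j)"
  unfolding divide_fact_eq by (intro ord_ge_const4_mult ord_ge_power1)

lemma formal_exp_adic:
  assumes "ord_ge 1 f"
  shows "formal_exp f = adic_sum (\<lambda>j. f ^ j / fact j) UNIV"
  unfolding formal_exp_def
  by (intro formal_sum_adic adic_family_seq ord_ge_exp_term assms)

lemma formal_exp_add:
  assumes f: "ord_ge 1 f" and g: "ord_ge 1 g"
  shows "formal_exp (f + g) = formal_exp f * formal_exp g"
proof -
  have *: "(\<Sum>i\<le>n. f ^ i / fact i * (g ^ (n - i) / fact (n - i))) = (f + g) ^ n / fact n" for n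
    unfolding binomial_ring sum_divide_distrib
    by (intro sum.cong refl) (simp add: binomial_fact)
  have "formal_exp f * formal_exp g =
          adic_sum (\<lambda>n. \<Sum>i\<le>n. f ^ i / fact i * (g ^ (n - i) / fact (n - i))) UNIV"
    unfolding formal_exp_adic[OF f] formal_exp_adic[OF g]
    by (intro adic_sum_Cauchy_product ord_ge_exp_term f g)
  thus ?thesis
    unfolding * formal_exp_adic[OF ord_ge_add[OF f g]] by simp
qed

lemma ord_ge_formal_exp_minus_1:
  assumes "ord_ge N f" "1 \<le> N"
  shows "ord_ge N (formal_exp f - 1)"
proof -
  have f: "ord_ge 1 f" using assms by (rule ord_ge_mono)
  have "ord_ge N (f ^ j / fact j)" if "j \<noteq> 0" for j
    unfolding divide_fact_eq
    by (rule ord_ge_const4_mult, rule ord_ge_mono[OF ord_ge_power[OF assms(1)]]) (use that in simp)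
  hence "ord_ge N (adic_sum (\<lambda>j. f ^ j / fact j) UNIV - (\<Sum>j\<in>{0}. f ^ j / fact j))"
    by (intro adic_sum_approx adic_family_seq ord_ge_exp_term f) auto
  thus ?thesis by (simp add: formal_exp_adic[OF f])
qed

lemma formal_exp_0 [simp]: "formal_exp 0 = 1"
proof (rule ord_ge_eqI)
  show "ord_ge N (formal_exp 0 - 1)" for N
    using ord_ge_formal_exp_minus_1[of "Suc N" 0] ord_ge_mono by auto
qed

lemma ord_ge_formal_exp: "ord_ge 1 f \<Longrightarrow> ord_ge 0 (formal_exp f)"
  by (rule ord_ge_diff_imp_0[OF ord_ge_formal_exp_minus_1]) auto

text \<open>
  The exponential is continuous: exp f - exp g = exp g (exp (f - g) - 1).
\<close>

lemma formal_exp_cong: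
  assumes "ord_ge 1 f" "ord_ge 1 g" "ord_ge N (f - g)"
  shows "ord_ge N (formal_exp f - formal_exp g)"
proof (cases "N = 0")
  case True
  thus ?thesis using assms by (auto intro!: ord_ge_diff ord_ge_formal_exp)
next
  case False
  have "formal_exp f = formal_exp g * formal_exp (f - g)"
    using formal_exp_add[OF assms(2) ord_ge_diff[OF assms(1,2)]] by simp
  hence "formal_exp f - formal_exp g = formal_exp g * (formal_exp (f - g) - 1)"
    by (simp add: algebra_simps)
  moreover have "ord_ge N (formal_exp g * (formal_exp (f - g) - 1))"
    using ord_ge_mult[OF ord_ge_formal_exp[OF assms(2)] ord_ge_formal_exp_minus_1[OF assms(3)]] False
    by simp
  ultimately show ?thesis by simp
qed

lemma formal_exp_sum:
  assumes "\<And>i. i \<in> F \<Longrightarrow> ord_ge 1 (g i)"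
  shows "formal_exp (\<Sum>i\<in>F. g i) = (\<Prod>i\<in>F. formal_exp (g i))"
  using assms
  by (induction F rule: infinite_finite_induct) (auto simp: formal_exp_add ord_ge_sum)

text \<open>
  Negative multiples occur because the exponents 12 c may have either sign.
\<close>

lemma formal_exp_of_int_mult:
  assumes "ord_ge 1 f"
  shows "formal_exp (of_int r * f) = formal_exp f powi r"
proof -
  have nat: "formal_exp (of_nat n * f) = formal_exp f ^ n" for n
    using formal_exp_sum[of "{..<n}" "\<lambda>_. f"] assms by simp
  show ?thesis
  proof (cases "r \<ge> 0")
    case True
    thus ?thesis using nat[of "nat r"] by (simp add: power_int_def)
  next
    case False
    define n where "n = nat (- r)"
    have r: "r = - int n" using False by (simp add: n_def)
    have ord: "ord_ge 1 (of_int s * f)" for s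
      unfolding of_int_eq_const4 by (rule ord_ge_const4_mult[OF assms])
    have "formal_exp (of_int r * f) * formal_exp (of_nat n * f) = 1"
      using formal_exp_add[OF ord[of r] ord[of "int n"]] by (simp add: r)
    hence "formal_exp (of_int r * f) = inverse (formal_exp f ^ n)"
      unfolding nat by (metis inverse_unique mult.commute)
    thus ?thesis by (simp add: r power_int_minus)
  qed
qed

text \<open>
  A finite subproduct is the exponential of a partial sum, and the exponential is continuous.
\<close>

lemma has_formal_prod_formal_exp:
  assumes fam: "adic_family g I" and ord: "\<And>i. i \<in> I \<Longrightarrow> ord_ge 1 (g i)"
  shows "has_formal_prod (\<lambda>i. formal_exp (g i)) I (formal_exp (adic_sum g I))"
  unfolding has_formal_prod_def
proof (intro allI)
  fix m n l k
  define N where "N = nat (weight m n l k + 1)"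
  show "\<forall>\<^sub>F F in finite_subsets_at_top I. coeff4 (\<Prod>i\<in>F. formal_exp (g i)) m n l k =
          coeff4 (formal_exp (adic_sum g I)) m n l k"
    unfolding eventually_finite_subsets_at_top
  proof (intro exI[of _ "{i\<in>I. \<not> ord_ge N (g i)}"] conjI allI impI)
    fix F assume F: "finite F \<and> {i\<in>I. \<not> ord_ge N (g i)} \<subseteq> F \<and> F \<subseteq> I"
    have prod: "(\<Prod>i\<in>F. formal_exp (g i)) = formal_exp (sum g F)"
      using F by (subst formal_exp_sum) (auto intro!: ord simp del: One_nat_def)
    have "ord_ge N (adic_sum g I - sum g F)"
      using F by (intro adic_sum_approx[OF fam]) auto
    moreover have "ord_ge 1 (sum g F)"
      using F by (intro ord_ge_sum ord) auto
    ultimately have "ord_ge N (formal_exp (adic_sum g I) - formal_exp (sum g F))"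
      by (intro formal_exp_cong ord_ge_adic_sum[OF fam] ord)
    from ord_ge_coeff_eq[OF this, of m n l k]
    show "coeff4 (\<Prod>i\<in>F. formal_exp (g i)) m n l k =
          coeff4 (formal_exp (adic_sum g I)) m n l k"
      unfolding prod by (simp add: N_def)
  qed (use fam in \<open>auto simp: adic_family_def\<close>)
qed

subsection \<open>The logarithm\<close>

lemma const4_sum: "const4 (sum f A) = (\<Sum>i\<in>A. const4 (f i))"
  by (induction A rule: infinite_finite_induct) (simp_all add: const4_add)

text \<open>
  The identity exp(-log(1 - X)) = 1/(1 - X): the product below has derivative 0, because the
  logarithm has derivative 1/(1 - X). At j = 0 the coefficient is the inverse of 0, which is 0.
\<close>

lemma fps_exp_log_geometric:
  "(fps_exp 1 oo Abs_fps (\<lambda>j. inverse (of_nat j))) * (1 - fps_X) = (1 :: complex fps)"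
proof -
  define L :: "complex fps" where "L = Abs_fps (\<lambda>j. inverse (of_nat j))"
  define D where "D = fps_exp 1 oo L"
  have dL: "fps_deriv L * (1 - fps_X) = 1"
  proof -
    have "fps_deriv L = Abs_fps (\<lambda>_. 1)"
      by (rule fps_ext) (simp add: L_def del: of_nat_Suc)
    thus ?thesis by (metis fps_inverse_gp' inverse_mult_eq_1 fps_inverse_idempotent
      fps_nth_Abs_fps mult.commute zero_neq_one)
  qed
  have "fps_deriv D = D * fps_deriv L"
    unfolding D_def by (subst fps_compose_deriv) (simp_all add: L_def)
  hence "fps_deriv (D * (1 - fps_X)) = D * (fps_deriv L * (1 - fps_X)) - D"
    by (simp add: algebra_simps)
  hence "fps_deriv (D * (1 - fps_X)) = 0"
    by (simp add: dL)
  hence "D * (1 - fps_X) = fps_const (fps_nth (D * (1 - fps_X)) 0)"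
    by (rule fps_deriv_eq_0_iff[THEN iffD1])
  thus ?thesis by (simp add: D_def L_def)
qed

text \<open>
  Evaluation at x transports identities between power series in one variable to series of
  positive order.
\<close>

definition fps_at :: "series4 \<Rightarrow> complex fps \<Rightarrow> series4" where
  "fps_at x F = adic_sum (\<lambda>j. const4 (fps_nth F j) * x ^ j) UNIV"

context
  fixes x :: series4
  assumes x: "ord_ge 1 x"
begin

lemma fps_at_approx: "ord_ge N (fps_at x F - (\<Sum>j<N. const4 (fps_nth F j) * x ^ j))"
  unfolding fps_at_def by (intro adic_sum_seq_approx ord_ge_const4_mult ord_ge_power1 x)

lemma fps_at_mult: "fps_at x (F * G) = fps_at x F * fps_at x G"
proof -
  have "(\<Sum>i\<le>n. const4 (fps_nth F i) * x ^ i * (const4 (fps_nth G (n - i)) * x ^ (n - i))) =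
          const4 (fps_nth (F * G) n) * x ^ n" for n
    unfolding fps_mult_nth const4_sum sum_distrib_right atMost_atLeast0
    by (intro sum.cong refl) (simp add: const4_mult power_add[symmetric] mult_ac)
  thus ?thesis
    unfolding fps_at_def
    by (subst adic_sum_Cauchy_product) (auto intro!: ord_ge_const4_mult ord_ge_power1 x simp del: One_nat_def)
qed

lemma fps_at_1: "fps_at x 1 = 1"
proof (rule ord_ge_eqI)
  fix N
  have "(\<Sum>j<Suc N. const4 (fps_nth 1 j) * x ^ j) = (\<Sum>j\<in>{0}. const4 (fps_nth 1 j) * x ^ j)"
    by (rule sum.mono_neutral_right) auto
  thus "ord_ge N (fps_at x 1 - 1)"
    using fps_at_approx[of "Suc N" 1] by (auto intro: ord_ge_mono simp del: sum.lessThan_Suc)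
qed

lemma fps_at_1_minus_X: "fps_at x (1 - fps_X) = 1 - x"
proof (rule ord_ge_eqI)
  fix N
  have "(\<Sum>j<Suc (Suc N). const4 (fps_nth (1 - fps_X) j) * x ^ j) =
        (\<Sum>j\<in>{0,1}. const4 (fps_nth (1 - fps_X) j) * x ^ j)"
    by (rule sum.mono_neutral_right) auto
  also have "\<dots> = 1 - x"
    by (simp add: const4_minus_1)
  finally show "ord_ge N (fps_at x (1 - fps_X) - (1 - x))"
    using fps_at_approx[of "Suc (Suc N)" "1 - fps_X"]
    by (auto intro: ord_ge_mono simp del: sum.lessThan_Suc)
qed

lemma fps_at_power: "fps_at x (F ^ j) = fps_at x F ^ j"
  by (induction j) (simp_all add: fps_at_1 fps_at_mult)

lemma ord_ge_fps_at:
  assumes "fps_nth F 0 = 0"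
  shows "ord_ge 1 (fps_at x F)"
  using fps_at_approx[of 1 F] assms by simp

lemma formal_exp_fps_at:
  assumes L0: "fps_nth L 0 = 0"
  shows "formal_exp (fps_at x L) = fps_at x (fps_exp 1 oo L)"
proof (rule ord_ge_eqI)
  fix N
  let ?e = "\<lambda>j. const4 (inverse (fact j))"
  have 1: "ord_ge N (formal_exp (fps_at x L) - (\<Sum>j<N. fps_at x L ^ j / fact j))"
    unfolding formal_exp_adic[OF ord_ge_fps_at[OF L0]]
    by (intro adic_sum_seq_approx ord_ge_exp_term ord_ge_fps_at L0)
  have "ord_ge N (\<Sum>j<N. ?e j * (fps_at x (L ^ j) - (\<Sum>i<N. const4 (fps_nth (L ^ j) i) * x ^ i)))"
    by (intro ord_ge_sum ord_ge_const4_mult fps_at_approx)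
  also have "(\<Sum>j<N. ?e j * (fps_at x (L ^ j) - (\<Sum>i<N. const4 (fps_nth (L ^ j) i) * x ^ i))) =
      (\<Sum>j<N. fps_at x L ^ j / fact j) -
      (\<Sum>j<N. \<Sum>i<N. const4 (inverse (fact j) * fps_nth (L ^ j) i) * x ^ i)"
    by (simp add: divide_fact_eq fps_at_power right_diff_distrib sum_subtractf sum_distrib_left
                  const4_mult mult.assoc)
  also have "(\<Sum>j<N. \<Sum>i<N. const4 (inverse (fact j) * fps_nth (L ^ j) i) * x ^ i) =
      (\<Sum>i<N. const4 (fps_nth (fps_exp 1 oo L) i) * x ^ i)"
  proof (subst sum.swap, intro sum.cong refl)
    fix i assume i: "i \<in> {..<N}"
    have "fps_nth (fps_exp 1 oo L) i = (\<Sum>j=0..i. inverse (fact j) * fps_nth (L ^ j) i)"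
      by (simp add: fps_compose_nth field_simps)
    also have "\<dots> = (\<Sum>j<N. inverse (fact j) * fps_nth (L ^ j) i)"
      using i L0 by (intro sum.mono_neutral_left) (auto simp: startsby_zero_power_prefix)
    finally show "(\<Sum>j<N. const4 (inverse (fact j) * fps_nth (L ^ j) i) * x ^ i) =
        const4 (fps_nth (fps_exp 1 oo L) i) * x ^ i"
      by (simp add: const4_sum sum_distrib_right)
  qed
  finally have 2: "ord_ge N ((\<Sum>j<N. fps_at x L ^ j / fact j) -
      (\<Sum>i<N. const4 (fps_nth (fps_exp 1 oo L) i) * x ^ i))" .
  show "ord_ge N (formal_exp (fps_at x L) - fps_at x (fps_exp 1 oo L))"
    by (rule ord_ge_trans[OF 1 ord_ge_trans[OF 2 ord_ge_commute[OF fps_at_approx]]])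
qed

lemma formal_Li1_adic:
  "formal_Li1 x = fps_at x (Abs_fps (\<lambda>j. inverse (of_nat j)))"
proof -
  have ord: "ord_ge j (x ^ j / of_nat j)" for j
    unfolding divide_of_nat_eq by (intro ord_ge_const4_mult ord_ge_power1 x)
  have "formal_Li1 x = adic_sum (\<lambda>j. x ^ j / of_nat j) {1..}"
    unfolding formal_Li1_def by (intro formal_sum_adic adic_family_seq ord)
  also have "\<dots> = adic_sum (\<lambda>j. x ^ j / of_nat j) UNIV"
  proof -
    have "{j \<in> {1..}. coeff4 (x ^ j / of_nat j) m n l k \<noteq> 0} =
          {j \<in> UNIV. coeff4 (x ^ j / of_nat j) m n l k \<noteq> 0}" for m n l k
      by (auto intro!: Suc_leI gr0I)
    thus ?thesis unfolding adic_sum_def by simp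
  qed
  also have "\<dots> = fps_at x (Abs_fps (\<lambda>j. inverse (of_nat j)))"
    by (simp add: fps_at_def divide_of_nat_eq)
  finally show ?thesis .
qed

text \<open>
  In a field the inverse is unique, so the expansion of 1/(1 - x) needs no separate discussion.
\<close>

lemma formal_exp_Li1: "formal_exp (formal_Li1 x) = inverse (1 - x)"
proof -
  have "formal_exp (formal_Li1 x) * (1 - x) = 1"
    unfolding formal_Li1_adic
    by (subst formal_exp_fps_at)
       (simp_all add: fps_at_1_minus_X[symmetric] fps_at_mult[symmetric] fps_exp_log_geometric fps_at_1)
  thus ?thesis by (metis inverse_unique mult.commute)
qed

lemma ord_ge_formal_Li1:
  assumes "ord_ge N x"
  shows "ord_ge N (formal_Li1 x)"
  unfolding formal_Li1_adic fps_at_def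
proof (rule ord_ge_adic_sum)
  show "ord_ge N (const4 (fps_nth (Abs_fps (\<lambda>j. inverse (of_nat j))) j) * x ^ j)" for j
    by (cases "j = 0")
       (auto intro!: ord_ge_const4_mult ord_ge_mono[OF ord_ge_power[OF assms, of j]])
qed (intro adic_family_seq ord_ge_const4_mult ord_ge_power1 x)

lemma formal_exp_int_Li1: "formal_exp (of_int r * formal_Li1 x) = (1 - x) powi (- r)"
  by (simp add: formal_exp_of_int_mult ord_ge_formal_Li1 x formal_exp_Li1 power_int_inverse
                power_int_minus del: One_nat_def)

end

subsection \<open>Monomials\<close>

definition monomial :: "nat \<times> nat \<times> int \<times> int \<Rightarrow> series4" where
  "monomial = (\<lambda>(m, n, l, k). var_Q ^ m * var_q ^ n * var_y powi l * var_t powi k)"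

lemma coeff4_monomial:
  "coeff4 (monomial (m, n, l, k)) M N L K =
     (if M = int m \<and> N = int n \<and> L = l \<and> K = k then 1 else 0)"
proof -
  define T :: "complex fls" where "T = fls_X powi k"
  define Y :: "complex fls fls" where "Y = fls_X powi l * fls_const T"
  define Z :: series3 where "Z = fls_X ^ n * fls_const Y"
  have q: "var_q ^ n = fls_const (fls_X ^ n)"
    unfolding var_q_def by (simp only: fls_const_power)
  have y: "var_y powi l = fls_const (fls_const (fls_X powi l))"
    unfolding var_y_def by (simp only: fls_const_power_int)
  have t: "var_t powi k = fls_const (fls_const (fls_const T))"
    unfolding var_t_def T_def by (simp only: fls_const_power_int)
  have "monomial (m, n, l, k) = fls_X ^ m * fls_const Z"
    unfolding monomial_def prod.case q y t Z_def Y_def var_Q_def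
    by (simp only: mult.assoc fls_const_mult_const)
  hence "fls_nth (monomial (m, n, l, k)) M = (if M = int m then Z else 0)" for M
    by (simp add: fls_X_power_times_conv_shift)
  moreover have "fls_nth Z N = (if N = int n then Y else 0)" for N
    by (simp add: Z_def fls_X_power_times_conv_shift)
  moreover have "fls_nth Y L = (if L = l then T else 0)" for L
    by (simp add: Y_def fls_X_intpow_times_conv_shift)
  moreover have "fls_nth T K = (if K = k then 1 else 0)" for K
    by (simp add: T_def)
  ultimately show ?thesis by (simp add: coeff4_def)
qed

lemma monomial_power:
  "monomial (m, n, l, k) ^ j = monomial (j * m, j * n, int j * l, int j * k)"
proof -
  have "(x powi i) ^ j = x powi (int j * i)" for x :: series4 and i
    by (simp add: power_int_mult mult.commute[of "int j"])
  thus ?thesis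
    by (simp add: monomial_def power_mult_distrib power_mult[symmetric] mult.commute[of j])
qed

lemma ord_ge_monomial:
  assumes "in_cone (int m) (int n) l k" "int N \<le> weight (int m) (int n) l k"
  shows "ord_ge N (monomial (m, n, l, k))"
  using assms by (auto simp: ord_ge_def coeff4_monomial split: if_splits)

lemma coeff4_Li1_monomial:
  assumes "ord_ge 1 (monomial (m, n, l, k))"
  shows "coeff4 (formal_Li1 (monomial (m, n, l, k))) M N L K =
    (\<Sum>j | j > 0 \<and> M = int (j * m) \<and> N = int (j * n) \<and> L = int j * l \<and> K = int j * k.
       inverse (of_nat j))"
proof -
  let ?g = "\<lambda>j. const4 (fps_nth (Abs_fps (\<lambda>j. inverse (of_nat j))) j) * monomial (m, n, l, k) ^ j"
  have coeff: "coeff4 (?g j) M N L K =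
      (if M = int (j * m) \<and> N = int (j * n) \<and> L = int j * l \<and> K = int j * k
       then inverse (of_nat j) else 0)" for j
    unfolding coeff4_const4_mult monomial_power coeff4_monomial by simp
  have "adic_family ?g UNIV"
    by (intro adic_family_seq ord_ge_const4_mult ord_ge_power1 assms)
  from coeff4_adic_sum[OF this, of M N L K] show ?thesis
    unfolding formal_Li1_adic[OF assms] fps_at_def coeff
    by (simp add: conj_ac cong: conj_cong)
qed

section \<open>Uniqueness of expansions\<close>

lemma e2pi_add: "e2pi (w + w') = e2pi w * e2pi w'"
  by (simp add: e2pi_def distrib_left exp_add)

lemma e2pi_nonzero [simp]: "e2pi w \<noteq> 0"
  by (simp add: e2pi_def)

lemma e2pi_0 [simp]: "e2pi 0 = 1"
  by (simp add: e2pi_def)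

lemma e2pi_of_int [simp]: "e2pi (of_int n) = 1"
  unfolding e2pi_def using exp_integer_2pi[of "of_int n"] by (simp add: mult_ac)

lemma e2pi_of_nat [simp]: "e2pi (of_nat n) = 1"
  using e2pi_of_int[of "int n"] by (simp del: e2pi_of_int)

lemma e2pi_of_int_mult: "e2pi (of_int n * w) = e2pi w powi n"
  unfolding e2pi_def by (subst exp_power_int) (simp add: mult_ac)

lemma e2pi_of_nat_mult: "e2pi (of_nat n * w) = e2pi w ^ n"
  using e2pi_of_int_mult[of "int n" w] by simp

lemma norm_e2pi: "norm (e2pi w) = exp (- (2 * pi * Im w))"
  by (simp add: e2pi_def norm_exp_eq_Re)

lemma norm_e2pi_of_real [simp]: "norm (e2pi (of_real \<theta>)) = 1"
  by (simp add: norm_e2pi)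

lemma e2pi_eq_1_iff: "e2pi w = 1 \<longleftrightarrow> w \<in> \<int>"
proof
  assume "e2pi w = 1"
  then obtain n :: int where "Re (2 * of_real pi * \<i> * w) = 0" "Im (2 * of_real pi * \<i> * w) = of_int (2 * n) * pi"
    unfolding e2pi_def exp_eq_1 by auto
  hence "w = of_int n" by (auto simp: complex_eq_iff)
  thus "w \<in> \<int>" by simp
qed (auto elim!: Ints_cases)

lemma sum_roots_of_unity:
  fixes r :: int
  assumes p: "p > 0"
  shows "(\<Sum>j<p. e2pi (of_nat j * of_int r / of_nat p)) = (if int p dvd r then of_nat p else 0)"
proof -
  define w where "w = e2pi (of_int r / of_nat p)"
  have pow: "e2pi (of_nat j * of_int r / of_nat p) = w ^ j" for j
    using e2pi_of_nat_mult[of j "of_int r / of_nat p"] by (simp add: w_def)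
  have wp: "w ^ p = 1"
    using e2pi_of_nat_mult[of p "of_int r / of_nat p"] p by (simp add: w_def)
  have w1: "w = 1 \<longleftrightarrow> int p dvd r"
  proof
    assume "w = 1"
    then obtain n where "of_int r / of_nat p = (of_int n :: complex)"
      by (auto simp: w_def e2pi_eq_1_iff elim: Ints_cases)
    hence "of_int r = (of_int (n * int p) :: complex)" using p by (simp add: field_simps)
    hence "r = n * int p" by (simp only: of_int_eq_iff)
    thus "int p dvd r" by simp
  next
    assume "int p dvd r"
    then obtain n where "r = int p * n" by (elim dvdE)
    thus "w = 1" using p by (simp add: w_def)
  qed
  show ?thesis
  proof (cases "int p dvd r")
    case True
    hence "w = 1" by (simp add: w1)
    with True show ?thesis by (simp add: pow)
  next
    case False
    hence "w \<noteq> 1" by (simp add: w1)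
    with False show ?thesis by (simp add: pow sum_gp_strict wp)
  qed
qed

lemma has_sum_diff:
  fixes f g :: "'a \<Rightarrow> complex"
  assumes "(f has_sum a) A" "(g has_sum b) A"
  shows "((\<lambda>x. f x - g x) has_sum (a - b)) A"
  using has_sum_add[OF assms(1) has_sum_uminusI[OF assms(2)]] by simp

lemma has_sum_finite_sum:
  fixes f :: "'i \<Rightarrow> 'a \<Rightarrow> 'b :: topological_comm_monoid_add"
  assumes "\<And>i. i \<in> F \<Longrightarrow> (f i has_sum s i) A"
  shows "((\<lambda>x. \<Sum>i\<in>F. f i x) has_sum (\<Sum>i\<in>F. s i)) A"
  using assms by (induction F rule: infinite_finite_induct) (auto intro: has_sum_add)

text \<open>
  Averaging the hypothesis over the angles j/p kills all terms except those with \<open>\<phi> v\<close> congruent to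
  N modulo p. As p grows, the terms other than those with \<open>\<phi> v = N\<close> leave every finite set, so their
  sum tends to 0 by absolute convergence.
\<close>

lemma has_sum_fourier_coeff_zero:
  fixes G :: "'a \<Rightarrow> complex" and \<phi> :: "'a \<Rightarrow> int"
  assumes "\<And>\<theta> :: real. ((\<lambda>v. G v * e2pi (of_real \<theta> * of_int (\<phi> v))) has_sum 0) UNIV"
  shows "((\<lambda>v. if \<phi> v = N then G v else 0) has_sum 0) UNIV"
proof -
  have "(G has_sum 0) UNIV" using assms[of 0] by simp
  hence absG: "(\<lambda>v. norm (G v)) summable_on UNIV"
    using summable_on_iff_abs_summable_on_complex has_sum_imp_summable by blast
  have abs_sub: "(\<lambda>v. norm (if P v then G v else 0)) summable_on A" for P A
    by (rule summable_on_comparison_test[OF summable_on_subset_banach[OF absG]]) auto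
  have sub: "(\<lambda>v. if P v then G v else 0) summable_on A" for P A
    using abs_sub[of P A] summable_on_iff_abs_summable_on_complex by blast
  have character: "e2pi (- (of_nat j * of_int N / of_nat p)) *
       (G v * e2pi (of_real (real j / real p) * of_int (\<phi> v))) =
     G v * e2pi (of_nat j * of_int (\<phi> v - N) / of_nat p)" for j p v
  proof -
    have "of_nat j * of_int (\<phi> v - N) / of_nat p =
            - (of_nat j * of_int N / of_nat p) + of_real (real j / real p) * (of_int (\<phi> v) :: complex)"
      by (simp add: field_simps diff_divide_distrib)
    thus ?thesis by (simp only: e2pi_add mult_ac)
  qed
  have per: "((\<lambda>v. if int p dvd \<phi> v - N then G v else 0) has_sum 0) UNIV" if p: "p > 0" for p
  proof -
    have "((\<lambda>v. \<Sum>j<p. e2pi (- (of_nat j * of_int N / of_nat p)) *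
             (G v * e2pi (of_real (real j / real p) * of_int (\<phi> v)))) has_sum
           (\<Sum>j<p. e2pi (- (of_nat j * of_int N / of_nat p)) * 0)) UNIV"
      by (intro has_sum_finite_sum has_sum_cmult_right assms)
    also have "(\<lambda>v. \<Sum>j<p. e2pi (- (of_nat j * of_int N / of_nat p)) *
             (G v * e2pi (of_real (real j / real p) * of_int (\<phi> v)))) =
        (\<lambda>v. of_nat p * (if int p dvd \<phi> v - N then G v else 0))"
    proof
      fix v
      have "(\<Sum>j<p. e2pi (- (of_nat j * of_int N / of_nat p)) *
              (G v * e2pi (of_real (real j / real p) * of_int (\<phi> v)))) =
            G v * (\<Sum>j<p. e2pi (of_nat j * of_int (\<phi> v - N) / of_nat p))"
        unfolding sum_distrib_left
        by (intro sum.cong refl) (rule character)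
      thus "(\<Sum>j<p. e2pi (- (of_nat j * of_int N / of_nat p)) *
              (G v * e2pi (of_real (real j / real p) * of_int (\<phi> v)))) =
            of_nat p * (if int p dvd \<phi> v - N then G v else 0)"
        unfolding sum_roots_of_unity[OF p] by simp
    qed
    finally show ?thesis using p by (simp add: has_sum_cmult_right_iff)
  qed
  let ?s = "infsum (\<lambda>v. if \<phi> v = N then G v else 0) UNIV"
  have small: "norm ?s \<le> \<epsilon>" if \<epsilon>: "\<epsilon> > 0" for \<epsilon>
  proof -
    obtain F where F: "finite F" "dist (sum (\<lambda>v. norm (G v)) F) (infsum (\<lambda>v. norm (G v)) UNIV) \<le> \<epsilon>"
      using infsum_finite_approximation[OF absG \<epsilon>] by auto
    \<comment> \<open>p exceeds all distances to N on F, so only \<open>\<phi> v = N\<close> survives in F\<close>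
    define p where "p = nat (Max (insert 0 ((\<lambda>v. \<bar>\<phi> v - N\<bar>) ` F)) + 1)"
    have p: "int p > \<bar>\<phi> v - N\<bar>" if "v \<in> F" for v
    proof -
      have "\<bar>\<phi> v - N\<bar> \<le> Max (insert 0 ((\<lambda>v. \<bar>\<phi> v - N\<bar>) ` F))"
        using F(1) that by (intro Max_ge) auto
      thus ?thesis by (simp add: p_def)
    qed
    have p0: "p > 0"
    proof -
      have "0 \<le> Max (insert 0 ((\<lambda>v. \<bar>\<phi> v - N\<bar>) ` F))"
        using F(1) by (intro Max_ge) auto
      thus ?thesis by (simp add: p_def)
    qed
    let ?g = "\<lambda>v. if int p dvd \<phi> v - N \<and> \<phi> v \<noteq> N then G v else 0"
    have "((\<lambda>v. (if int p dvd \<phi> v - N then G v else 0) - (if \<phi> v = N then G v else 0))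
             has_sum (0 - ?s)) UNIV"
      by (intro has_sum_diff per p0 has_sum_infsum sub)
    also have "(\<lambda>v. (if int p dvd \<phi> v - N then G v else 0) - (if \<phi> v = N then G v else 0)) = ?g"
      by auto
    finally have g: "(?g has_sum (0 - ?s)) UNIV" .
    have gz: "?g v = 0" if "v \<in> F" for v
      using p[OF that] zdvd_not_zless[of "\<bar>\<phi> v - N\<bar>" "int p"] by auto
    have "(?g has_sum (0 - ?s)) (- F)"
      using g by (rule has_sum_cong_neutral[THEN iffD1, rotated -1]) (use gz in auto)
    hence "norm (0 - ?s) \<le> infsum (\<lambda>v. norm (?g v)) (- F)"
      using norm_infsum_bound[OF abs_sub, of "\<lambda>v. int p dvd \<phi> v - N \<and> \<phi> v \<noteq> N" "- F"]
      by (simp only: infsumI)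
    also have "\<dots> \<le> infsum (\<lambda>v. norm (G v)) (- F)"
      by (intro infsum_mono abs_sub summable_on_subset_banach[OF absG]) auto
    also have "\<dots> = infsum (\<lambda>v. norm (G v)) UNIV - sum (\<lambda>v. norm (G v)) F"
      using infsum_Diff[OF absG, of F] F(1) by (simp add: Compl_eq_Diff_UNIV)
    also have "\<dots> \<le> \<epsilon>" using F(2) by (simp add: dist_real_def)
    finally show ?thesis by simp
  qed
  have "norm ?s \<le> 0" by (rule field_le_epsilon) (use small in auto)
  hence "?s = 0" by simp
  thus ?thesis using has_sum_infsum[OF sub, of "\<lambda>v. \<phi> v = N" UNIV] by simp
qed

definition expansion_term :: "complex \<Rightarrow> complex \<Rightarrow> complex \<Rightarrow> int \<times> int \<times> int \<Rightarrow> complex" where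
  "expansion_term \<tau> z x = (\<lambda>(n, l, k). e2pi \<tau> powi n * e2pi z powi l * e2pi x powi k)"

lemma expansion_term_nonzero [simp]: "expansion_term \<tau> z x v \<noteq> 0"
  by (simp add: expansion_term_def split: prod.splits)

lemma expansion_term_shift:
  "expansion_term (\<tau> + \<theta>) (z + \<theta>') (x + \<theta>'') (n, l, k) =
     expansion_term \<tau> z x (n, l, k) * e2pi (\<theta> * of_int n) * e2pi (\<theta>' * of_int l) * e2pi (\<theta>'' * of_int k)"
  using e2pi_of_int_mult[of n \<theta>] e2pi_of_int_mult[of l \<theta>'] e2pi_of_int_mult[of k \<theta>'']
  by (simp add: expansion_term_def e2pi_add power_int_mult_distrib mult.commute[of _ "of_int _"])

lemma has_expansion_altdef:
  "has_expansion N f a \<longleftrightarrow>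
     (\<forall>\<tau> z x. norm (e2pi \<tau>) < norm (e2pi x) ^ N \<and> norm (e2pi x) < 1 \<longrightarrow>
        ((\<lambda>(n, l, k). a n l k * expansion_term \<tau> z x (n, l, k)) has_sum f \<tau> z x) UNIV)"
  by (simp add: has_expansion_def expansion_term_def)

text \<open>
  Real shifts of the three arguments stay in the region of convergence and multiply the terms by
  characters; so the previous lemma separates the exponents of one variable after the other.
\<close>

lemma has_expansion_unique:
  assumes "has_expansion N f a" "has_expansion N f b"
  shows "a = b"
proof (intro ext)
  fix n l k
  \<comment> \<open>any base point of the region; here \<open>t\<close> has absolute value exp(-2\<pi>) and \<open>q\<close> its power N + 1\<close>
  define x where "x = \<i>"
  define \<tau> where "\<tau> = of_nat (N + 1) * \<i>"
  have reg: "norm (e2pi (\<tau> + of_real \<theta>)) < norm (e2pi (x + of_real \<theta>')) ^ N"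
            "norm (e2pi (x + of_real \<theta>')) < 1" for \<theta> \<theta>'
    by (simp_all add: norm_e2pi x_def \<tau>_def exp_of_nat_mult[symmetric] algebra_simps)
  define G where "G = (\<lambda>(n, l, k). (a n l k - b n l k) * expansion_term \<tau> 0 x (n, l, k))"
  have 0: "((\<lambda>(n, l, k). G (n, l, k) * e2pi (of_real \<theta>3 * of_int k) * e2pi (of_real \<theta>2 * of_int l) *
              e2pi (of_real \<theta>1 * of_int n)) has_sum 0) UNIV" for \<theta>1 \<theta>2 \<theta>3
  proof -
    have "((\<lambda>v. (case v of (n, l, k) \<Rightarrow> a n l k * expansion_term (\<tau> + of_real \<theta>1) (0 + of_real \<theta>2) (x + of_real \<theta>3) (n, l, k)) -
              (case v of (n, l, k) \<Rightarrow> b n l k * expansion_term (\<tau> + of_real \<theta>1) (0 + of_real \<theta>2) (x + of_real \<theta>3) (n, l, k)))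
            has_sum (f (\<tau> + of_real \<theta>1) (0 + of_real \<theta>2) (x + of_real \<theta>3) -
                     f (\<tau> + of_real \<theta>1) (0 + of_real \<theta>2) (x + of_real \<theta>3))) UNIV"
      using assms reg unfolding has_expansion_altdef by (intro has_sum_diff) blast+
    thus ?thesis
      unfolding expansion_term_shift
      by (simp add: G_def case_prod_unfold algebra_simps)
  qed
  have 1: "((\<lambda>v. if fst v = n then G v * e2pi (of_real \<theta>3 * of_int (snd (snd v))) *
             e2pi (of_real \<theta>2 * of_int (fst (snd v))) else 0) has_sum 0) UNIV" for \<theta>2 \<theta>3
    by (rule has_sum_fourier_coeff_zero) (use 0[of \<theta>3 \<theta>2] in \<open>simp add: case_prod_unfold\<close>)
  have 2: "((\<lambda>v. if fst (snd v) = l then if fst v = n then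
              G v * e2pi (of_real \<theta>3 * of_int (snd (snd v))) else 0 else 0) has_sum 0) UNIV" for \<theta>3
    by (rule has_sum_fourier_coeff_zero)
       (use 1[of \<theta>3] in \<open>simp add: if_distrib[of "\<lambda>x. x * _"] cong: if_cong\<close>)
  have 3: "((\<lambda>v. if snd (snd v) = k then if fst (snd v) = l then if fst v = n then G v
             else 0 else 0 else 0) has_sum 0) UNIV"
    by (rule has_sum_fourier_coeff_zero)
       (use 2 in \<open>simp add: if_distrib[of "\<lambda>x. x * _"] cong: if_cong\<close>)
  also have "(\<lambda>v. if snd (snd v) = k then if fst (snd v) = l then if fst v = n then G v
             else 0 else 0 else 0) = (\<lambda>v. if v = (n, l, k) then G (n, l, k) else 0)"
    by auto
  finally have "((\<lambda>v. if v = (n, l, k) then G (n, l, k) else 0) has_sum 0) UNIV" .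
  moreover have "((\<lambda>v. if v = (n, l, k) then G (n, l, k) else 0) has_sum G (n, l, k)) UNIV"
    by (rule has_sum_finite_neutralI[of "{(n, l, k)}"]) auto
  ultimately have "G (n, l, k) = 0" by (rule has_sum_unique[symmetric])
  thus "a n l k = b n l k" by (simp add: G_def)
qed

section \<open>Expansions with integer coefficients\<close>

text \<open>
  The support condition is the one satisfied by \<open>q\<close>, \<open>t\<close>, \<open>q/t\<close> and all of their products, with an
  arbitrary power of \<open>y\<close>; it bounds the pole order in \<open>t\<close> by the power of \<open>q\<close>.
\<close>

definition integral_expansion :: "(complex \<Rightarrow> complex \<Rightarrow> complex \<Rightarrow> complex) \<Rightarrow> bool" where
  "integral_expansion f \<longleftrightarrow> (\<exists>a :: int \<Rightarrow> int \<Rightarrow> int \<Rightarrow> int.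
     has_expansion 1 f (\<lambda>n l k. of_int (a n l k)) \<and>
     (\<forall>n l k. a n l k \<noteq> 0 \<longrightarrow> 0 \<le> n \<and> 0 \<le> n + k))"

lemma abs_summable_complex:
  fixes f :: "'a \<Rightarrow> complex"
  assumes "(f has_sum S) A"
  shows "(\<lambda>x. norm (f x)) summable_on A"
  using assms summable_on_iff_abs_summable_on_complex has_sum_imp_summable by blast

lemma has_sum_times:
  fixes f :: "'a \<Rightarrow> complex" and g :: "'b \<Rightarrow> complex"
  assumes f: "(f has_sum S) A" and g: "(g has_sum T) B"
  shows "((\<lambda>(x, y). f x * g y) has_sum S * T) (A \<times> B)"
proof (rule has_sum_SigmaI)
  show "((\<lambda>y. case (x, y) of (x, y) \<Rightarrow> f x * g y) has_sum f x * T) B" for x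
    by (simp add: has_sum_cmult_right g)
  show "((\<lambda>x. f x * T) has_sum S * T) A"
    by (rule has_sum_cmult_left[OF f])
  have "(\<lambda>p. norm (case p of (x, y) \<Rightarrow> f x * g y)) summable_on (A \<times> B)"
    unfolding Infinite_Sum.abs_summable_on_Sigma_iff
  proof (intro conjI ballI)
    show "(\<lambda>y. norm (case (x, y) of (x, y) \<Rightarrow> f x * g y)) summable_on B" for x
      by (simp add: norm_mult summable_on_cmult_right abs_summable_complex[OF g])
    show "(\<lambda>x. norm (infsum (\<lambda>y. norm (case (x, y) of (x, y) \<Rightarrow> f x * g y)) B)) summable_on A"
      by (simp add: norm_mult infsum_cmult_right' abs_mult summable_on_cmult_left abs_summable_complex[OF f])
  qed
  thus "(\<lambda>(x, y). f x * g y) summable_on (A \<times> B)"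
    using summable_on_iff_abs_summable_on_complex by blast
qed

text \<open>
  Collecting equal monomials keeps the coefficients integers: an absolutely summable family of
  integer multiples of one nonzero number has only finitely many nonzero members, so every
  coefficient is a finite sum. The finite sets do not depend on the point of evaluation.
\<close>

lemma integral_expansionI:
  fixes s :: "'i \<Rightarrow> int" and \<phi> :: "'i \<Rightarrow> int \<times> int \<times> int"
  assumes hs: "\<And>\<tau> z x. norm (e2pi \<tau>) < norm (e2pi x) \<Longrightarrow> norm (e2pi x) < 1 \<Longrightarrow>
      ((\<lambda>i. of_int (s i) * expansion_term \<tau> z x (\<phi> i)) has_sum f \<tau> z x) I"
    and supp: "\<And>i n l k. i \<in> I \<Longrightarrow> s i \<noteq> 0 \<Longrightarrow> \<phi> i = (n, l, k) \<Longrightarrow> 0 \<le> n \<and> 0 \<le> n + k"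
  shows "integral_expansion f"
proof -
  define fib where "fib v = {i \<in> I. \<phi> i = v \<and> s i \<noteq> 0}" for v
  define a where "a n l k = (\<Sum>i\<in>fib (n, l, k). s i)" for n l k
  have fin: "finite (fib v)" for v
  proof (rule ccontr)
    assume inf: "infinite (fib v)"
    \<comment> \<open>one point of the region suffices\<close>
    let ?W = "expansion_term (2 * \<i>) 0 \<i>"
    have "((\<lambda>i. of_int (s i) * ?W (\<phi> i)) has_sum f (2 * \<i>) 0 \<i>) I"
      by (rule hs) (simp_all add: norm_e2pi)
    hence "(\<lambda>i. norm (of_int (s i) * ?W (\<phi> i))) summable_on fib v"
      by (rule summable_on_subset_banach[OF abs_summable_complex]) (auto simp: fib_def)
    hence "(\<lambda>i. norm (?W v)) summable_on fib v"
    proof (rule summable_on_comparison_test)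
      fix i assume i: "i \<in> fib v"
      hence "1 \<le> \<bar>s i\<bar>" by (auto simp: fib_def)
      hence "1 \<le> norm (of_int (s i) :: complex)" by simp
      hence "1 * norm (?W v) \<le> norm (of_int (s i) :: complex) * norm (?W v)"
        by (rule mult_right_mono) simp
      thus "norm (?W v) \<le> norm (of_int (s i) * ?W (\<phi> i))"
        using i by (simp add: fib_def norm_mult)
    qed auto
    moreover have "\<not> (\<lambda>i. norm (?W v)) summable_on fib v"
      by (rule infsum_diverge_constant[OF inf]) simp
    ultimately show False by simp
  qed
  have "has_expansion 1 f (\<lambda>n l k. of_int (a n l k))"
    unfolding has_expansion_altdef
  proof (intro allI impI)
    fix \<tau> z x assume "norm (e2pi \<tau>) < norm (e2pi x) ^ 1 \<and> norm (e2pi x) < 1"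
    hence "((\<lambda>i. of_int (s i) * expansion_term \<tau> z x (\<phi> i)) has_sum f \<tau> z x) I"
      by (intro hs) auto
    also have "?this \<longleftrightarrow> ((\<lambda>(v, i). of_int (s i) * expansion_term \<tau> z x (\<phi> i)) has_sum f \<tau> z x)
                 (Sigma UNIV (\<lambda>v. {i \<in> I. \<phi> i = v}))"
      by (rule has_sum_reindex_bij_witness[of _ snd "\<lambda>i. (\<phi> i, i)"]) auto
    finally show "((\<lambda>(n, l, k). of_int (a n l k) * expansion_term \<tau> z x (n, l, k)) has_sum f \<tau> z x) UNIV"
    proof (rule has_sum_SigmaD)
      fix v :: "int \<times> int \<times> int"
      obtain n l k where v: "v = (n, l, k)" by (cases v)
      show "((\<lambda>i. case (v, i) of (v, i) \<Rightarrow> of_int (s i) * expansion_term \<tau> z x (\<phi> i)) has_sum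
              (case v of (n, l, k) \<Rightarrow> of_int (a n l k) * expansion_term \<tau> z x (n, l, k)))
             {i \<in> I. \<phi> i = v}"
        by (rule has_sum_finite_neutralI[of "fib v"])
           (use fin in \<open>auto simp: fib_def v a_def sum_distrib_right intro!: sum.cong\<close>)
    qed
  qed
  moreover have "0 \<le> n \<and> 0 \<le> n + k" if "a n l k \<noteq> 0" for n l k
  proof -
    obtain i where "i \<in> fib (n, l, k)" "s i \<noteq> 0"
      using \<open>a n l k \<noteq> 0\<close> unfolding a_def by (rule sum.not_neutral_contains_not_neutral)
    thus ?thesis using supp[of i n l k] by (auto simp: fib_def)
  qed
  ultimately show ?thesis unfolding integral_expansion_def by blast
qed

lemma expansion_term_add:
  "expansion_term \<tau> z x (v + w) = expansion_term \<tau> z x v * expansion_term \<tau> z x w"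
  by (cases v; cases w) (simp add: expansion_term_def power_int_add)

lemma expansion_term_0 [simp]: "expansion_term \<tau> z x 0 = 1"
  by (simp add: expansion_term_def zero_prod_def)

lemma expansion_term_sum:
  "expansion_term \<tau> z x (sum v A) = (\<Prod>i\<in>A. expansion_term \<tau> z x (v i))"
  by (induction A rule: infinite_finite_induct) (simp_all add: expansion_term_add)

lemma expansion_term_power:
  "expansion_term \<tau> z x (int j * n, int j * l, int j * k) = expansion_term \<tau> z x (n, l, k) ^ j"
  by (simp add: expansion_term_def power_int_mult power_mult_distrib mult.commute[of "int j"])

lemma integral_expansion_mult:
  assumes "integral_expansion f" "integral_expansion g"
  shows "integral_expansion (\<lambda>\<tau> z x. f \<tau> z x * g \<tau> z x)"
proof -
  obtain a where a: "has_expansion 1 f (\<lambda>n l k. of_int (a n l k))"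
    "\<And>n l k. a n l k \<noteq> 0 \<Longrightarrow> 0 \<le> n \<and> 0 \<le> n + k"
    using assms(1) unfolding integral_expansion_def by auto
  obtain b where b: "has_expansion 1 g (\<lambda>n l k. of_int (b n l k))"
    "\<And>n l k. b n l k \<noteq> 0 \<Longrightarrow> 0 \<le> n \<and> 0 \<le> n + k"
    using assms(2) unfolding integral_expansion_def by auto
  define s where "s = (\<lambda>((n, l, k), (n', l', k')). a n l k * b n' l' k')"
  define \<phi> where "\<phi> = (\<lambda>(v, w). v + w :: int \<times> int \<times> int)"
  show ?thesis
  proof (rule integral_expansionI)
    fix \<tau> z x assume reg: "norm (e2pi \<tau>) < norm (e2pi x)" "norm (e2pi x) < 1"
    from has_sum_times[OF a(1)[unfolded has_expansion_altdef, rule_format, of \<tau> x z]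
        b(1)[unfolded has_expansion_altdef, rule_format, of \<tau> x z]]
    show "((\<lambda>i. of_int (s i) * expansion_term \<tau> z x (\<phi> i)) has_sum f \<tau> z x * g \<tau> z x) UNIV"
      using reg by (simp add: case_prod_unfold expansion_term_add mult_ac s_def \<phi>_def)
  next
    fix i n l k assume *: "s i \<noteq> 0" "\<phi> i = (n, l, k)"
    obtain n1 l1 k1 n2 l2 k2 where "i = ((n1, l1, k1), (n2, l2, k2))"
      by (metis surj_pair)
    thus "0 \<le> n \<and> 0 \<le> n + k"
      using * a(2)[of n1 l1 k1] b(2)[of n2 l2 k2] by (auto simp: s_def \<phi>_def)
  qed
qed

subsection \<open>Infinite products\<close>

lemma finite_subset_incseq:
  fixes A :: "nat \<Rightarrow> 'a set"
  assumes "finite F" "F \<subseteq> (\<Union>n. A n)" "incseq A"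
  shows "\<exists>N. F \<subseteq> A N"
  using assms(1,2)
proof (induction F)
  case (insert x F)
  then obtain M N where "F \<subseteq> A M" "x \<in> A N" by auto
  moreover have "A M \<subseteq> A (max M N)" "A N \<subseteq> A (max M N)"
    using assms(3) by (auto simp: incseq_def)
  ultimately show ?case by blast
qed auto

lemma infsum_incseq_UN_tendsto:
  fixes f :: "'a \<Rightarrow> complex" and A :: "nat \<Rightarrow> 'a set"
  assumes abs: "(\<lambda>x. norm (f x)) summable_on (\<Union>n. A n)" and mono: "incseq A"
  shows "(\<lambda>n. infsum f (A n)) \<longlonglongrightarrow> infsum f (\<Union>n. A n)"
proof (rule LIMSEQ_I)
  fix \<epsilon> :: real assume \<epsilon>: "\<epsilon> > 0"
  define U where "U = (\<Union>n. A n)"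
  note abs = abs[folded U_def]
  have abs': "(\<lambda>x. norm (f x)) summable_on B" if "B \<subseteq> U" for B
    by (rule summable_on_subset_banach[OF abs that])
  have sub: "f summable_on B" if "B \<subseteq> U" for B
    using abs'[OF that] summable_on_iff_abs_summable_on_complex by blast
  obtain F where F: "finite F" "F \<subseteq> U"
    "dist (sum (\<lambda>x. norm (f x)) F) (infsum (\<lambda>x. norm (f x)) U) \<le> \<epsilon> / 2"
    using infsum_finite_approximation[OF abs, of "\<epsilon> / 2"] \<epsilon> by auto
  obtain N where N: "F \<subseteq> A N"
    using finite_subset_incseq[OF F(1) _ mono] F(2) by (auto simp: U_def)
  show "\<exists>N. \<forall>n\<ge>N. norm (infsum f (A n) - infsum f (\<Union>n. A n)) < \<epsilon>"
  proof (intro exI[of _ N] allI impI)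
    fix n assume "n \<ge> N"
    hence Fn: "F \<subseteq> A n" using N mono by (auto simp: incseq_def)
    have An: "A n \<subseteq> U" by (auto simp: U_def)
    have "norm (infsum f U - infsum f (A n)) = norm (infsum f (U - A n))"
      by (subst infsum_Diff[OF sub sub An]) (use An in auto)
    also have "\<dots> \<le> infsum (\<lambda>x. norm (f x)) (U - A n)"
      by (rule norm_infsum_bound[OF abs']) auto
    also have "\<dots> \<le> infsum (\<lambda>x. norm (f x)) (U - F)"
      by (rule infsum_mono2[OF abs' abs']) (use Fn in auto)
    also have "\<dots> = infsum (\<lambda>x. norm (f x)) U - sum (\<lambda>x. norm (f x)) F"
      using F(1) by (subst infsum_Diff[OF abs' abs' F(2)]) (use F(2) in auto)
    also have "\<dots> \<le> \<epsilon> / 2" using F(3) unfolding dist_real_def by linarith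
    also have "\<dots> < \<epsilon>" using \<epsilon> by simp
    finally show "norm (infsum f (A n) - infsum f (\<Union>n. A n)) < \<epsilon>"
      by (simp add: U_def norm_minus_commute)
  qed
qed

text \<open>
  The choice of one term from each of infinitely many factors, almost always the term of index 0,
  is a finitely supported function; these functions are the union of the sets \<open>supported_below N\<close>.
\<close>

definition supported_below :: "nat \<Rightarrow> (nat \<Rightarrow> nat) set" where
  "supported_below N = {f. \<forall>n\<ge>N. f n = 0}"

lemma supported_below_support:
  assumes "f \<in> supported_below N"
  shows "{n. f n \<noteq> 0} \<subseteq> {..<N}"
proof
  fix n assume "n \<in> {n. f n \<noteq> 0}"
  hence "\<not> N \<le> n" using assms by (auto simp: supported_below_def)
  thus "n \<in> {..<N}" by simp
qed

lemma has_sum_finite_product: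
  fixes g :: "nat \<Rightarrow> nat \<Rightarrow> complex"
  assumes "\<And>n. (g n has_sum V n) UNIV"
  shows "((\<lambda>f. \<Prod>n<N. g n (f n)) has_sum (\<Prod>n<N. V n)) (supported_below N)"
proof (induction N)
  case 0
  have "supported_below 0 = {\<lambda>_. 0}" by (auto simp: supported_below_def)
  thus ?case by (simp add: has_sum_finite_iff)
next
  case (Suc N)
  have "((\<lambda>(f, j). (\<Prod>n<N. g n (f n)) * g N j) has_sum (\<Prod>n<N. V n) * V N) (supported_below N \<times> UNIV)"
    by (rule has_sum_times[OF Suc assms])
  also have "?this \<longleftrightarrow> ((\<lambda>f. \<Prod>n<Suc N. g n (f n)) has_sum (\<Prod>n<N. V n) * V N) (supported_below (Suc N))"
  proof (rule has_sum_reindex_bij_witness[of _ "\<lambda>f. (f(N := 0), f N)" "\<lambda>(f, j). f(N := j)"])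
    fix p :: "(nat \<Rightarrow> nat) \<times> nat" assume p: "p \<in> supported_below N \<times> UNIV"
    obtain f j where fj: "p = (f, j)" by (cases p)
    have "(\<Prod>n<N. g n ((f(N := j)) n)) = (\<Prod>n<N. g n (f n))"
      by (rule prod.cong) auto
    thus "(\<Prod>n<Suc N. g n ((case p of (f, j) \<Rightarrow> f(N := j)) n)) =
            (case p of (f, j) \<Rightarrow> (\<Prod>n<N. g n (f n)) * g N j)"
      by (simp add: fj)
  qed (auto simp: supported_below_def fun_eq_iff)
  finally show ?case by simp
qed

text \<open>
  Partial products expand over \<open>supported_below N\<close>, and the sum of absolute values is bounded by the
  product of all 1 + \<open>\<epsilon> n\<close>, hence by the exponential of the sum of \<open>\<epsilon>\<close>.
\<close>

lemma has_sum_infinite_product: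
  fixes g :: "nat \<Rightarrow> nat \<Rightarrow> complex"
  assumes g0: "\<And>n. g n 0 = 1"
    and sums: "\<And>n. (g n has_sum V n) UNIV"
    and norms: "\<And>n. ((\<lambda>j. norm (g n j)) has_sum (1 + \<epsilon> n)) UNIV"
    and \<epsilon>: "summable \<epsilon>" "\<And>n. 0 \<le> \<epsilon> n"
    and lim: "(\<lambda>N. \<Prod>n<N. V n) \<longlonglongrightarrow> P"
  shows "((\<lambda>f. \<Prod>n | f n \<noteq> 0. g n (f n)) has_sum P) (\<Union>N. supported_below N)"
proof -
  let ?T = "\<lambda>f. \<Prod>n | f n \<noteq> 0. g n (f n)"
  have T: "?T f = (\<Prod>n<N. g n (f n))" if "f \<in> supported_below N" for f N
    using supported_below_support[OF that] by (intro prod.mono_neutral_left) (auto simp: g0)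
  have mono: "incseq supported_below"
    by (auto simp: incseq_def supported_below_def)
  have inT: "(?T has_sum (\<Prod>n<N. V n)) (supported_below N)" for N
    using has_sum_finite_product[where N = N, OF sums] by (rule has_sum_cong[THEN iffD1, rotated]) (rule T[symmetric])
  have normT: "((\<lambda>f. norm (?T f)) has_sum (\<Prod>n<N. 1 + \<epsilon> n)) (supported_below N)" for N
  proof -
    have "((\<lambda>j. complex_of_real (norm (g n j))) has_sum complex_of_real (1 + \<epsilon> n)) UNIV" for n
      by (simp only: has_sum_of_real_iff norms)
    from has_sum_Re[OF has_sum_finite_product[where N = N, OF this]]
    have "((\<lambda>f. \<Prod>n<N. norm (g n (f n))) has_sum (\<Prod>n<N. 1 + \<epsilon> n)) (supported_below N)"
      by (simp only: of_real_prod[symmetric] Re_complex_of_real)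
    thus ?thesis
      by (rule has_sum_cong[THEN iffD1, rotated]) (simp only: T prod_norm)
  qed
  have abs: "(\<lambda>f. norm (?T f)) summable_on (\<Union>N. supported_below N)"
  proof (rule nonneg_bdd_above_summable_on)
    show "bdd_above (sum (\<lambda>f. norm (?T f)) ` {F. F \<subseteq> (\<Union>N. supported_below N) \<and> finite F})"
    proof (rule bdd_aboveI2)
      fix F assume "F \<in> {F. F \<subseteq> (\<Union>N. supported_below N) \<and> finite F}"
      hence F: "F \<subseteq> (\<Union>N. supported_below N)" "finite F" by auto
      obtain N where N: "F \<subseteq> supported_below N"
        using finite_subset_incseq[OF F(2,1) mono] by auto
      have "(\<Sum>f\<in>F. norm (?T f)) \<le> (\<Prod>n<N. 1 + \<epsilon> n)"
        by (rule finite_sum_le_has_sum[OF normT F(2) N]) auto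
      also have "\<dots> \<le> exp (\<Sum>n<N. \<epsilon> n)"
        by (rule prod_le_exp_sum) (simp add: \<epsilon>)
      also have "\<dots> \<le> exp (suminf \<epsilon>)"
        using \<epsilon> by (simp add: sum_le_suminf)
      finally show "(\<Sum>f\<in>F. norm (?T f)) \<le> exp (suminf \<epsilon>)" .
    qed
  qed auto
  have "(\<lambda>N. infsum ?T (supported_below N)) \<longlonglongrightarrow> infsum ?T (\<Union>N. supported_below N)"
    by (rule infsum_incseq_UN_tendsto[OF abs mono])
  hence "(\<lambda>N. \<Prod>n<N. V n) \<longlonglongrightarrow> infsum ?T (\<Union>N. supported_below N)"
    unfolding infsumI[OF inT] .
  hence "infsum ?T (\<Union>N. supported_below N) = P"
    using lim by (rule LIMSEQ_unique)
  moreover have "?T summable_on (\<Union>N. supported_below N)"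
    using abs summable_on_iff_abs_summable_on_complex by blast
  hence "(?T has_sum infsum ?T (\<Union>N. supported_below N)) (\<Union>N. supported_below N)"
    by (rule has_sum_infsum)
  ultimately show ?thesis by (simp only:)
qed

text \<open>
  The factors are power series in monomials that differ only in the power of \<open>q\<close>.
\<close>

lemma integral_expansion_infinite_product:
  fixes s :: "nat \<Rightarrow> int" and \<nu> :: "nat \<Rightarrow> int" and l0 k0 :: int
  assumes s0: "s 0 = 1"
    and \<nu>: "\<And>n. 0 \<le> \<nu> n" "\<And>n. 0 \<le> \<nu> n + k0"
    and sums: "\<And>\<tau> z x n. norm (e2pi \<tau>) < norm (e2pi x) \<Longrightarrow> norm (e2pi x) < 1 \<Longrightarrow>
        ((\<lambda>j. of_int (s j) * expansion_term \<tau> z x (\<nu> n, l0, k0) ^ j) has_sum V \<tau> z x n) UNIV"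
    and norms: "\<And>\<tau> z x n. norm (e2pi \<tau>) < norm (e2pi x) \<Longrightarrow> norm (e2pi x) < 1 \<Longrightarrow>
        ((\<lambda>j. norm (of_int (s j) * expansion_term \<tau> z x (\<nu> n, l0, k0) ^ j)) has_sum 1 + \<epsilon> \<tau> z x n) UNIV"
    and \<epsilon>: "\<And>\<tau> z x. norm (e2pi \<tau>) < norm (e2pi x) \<Longrightarrow> norm (e2pi x) < 1 \<Longrightarrow> summable (\<epsilon> \<tau> z x)"
      "\<And>\<tau> z x n. norm (e2pi \<tau>) < norm (e2pi x) \<Longrightarrow> norm (e2pi x) < 1 \<Longrightarrow> 0 \<le> \<epsilon> \<tau> z x n"
    and lim: "\<And>\<tau> z x. norm (e2pi \<tau>) < norm (e2pi x) \<Longrightarrow> norm (e2pi x) < 1 \<Longrightarrow>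
        (\<lambda>N. \<Prod>n<N. V \<tau> z x n) \<longlonglongrightarrow> F \<tau> z x"
  shows "integral_expansion F"
proof (rule integral_expansionI)
  fix \<tau> z x assume reg: "norm (e2pi \<tau>) < norm (e2pi x)" "norm (e2pi x) < 1"
  have "((\<lambda>f. \<Prod>n | f n \<noteq> 0. of_int (s (f n)) * expansion_term \<tau> z x (\<nu> n, l0, k0) ^ f n) has_sum F \<tau> z x)
          (\<Union>N. supported_below N)"
    by (rule has_sum_infinite_product[OF _ sums[OF reg] norms[OF reg] \<epsilon>(1)[OF reg] \<epsilon>(2)[OF reg] lim[OF reg]])
       (simp add: s0)
  thus "((\<lambda>f. of_int (\<Prod>n | f n \<noteq> 0. s (f n)) *
            expansion_term \<tau> z x (\<Sum>n | f n \<noteq> 0. (int (f n) * \<nu> n, int (f n) * l0, int (f n) * k0)))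
          has_sum F \<tau> z x) (\<Union>N. supported_below N)"
    by (simp only: expansion_term_sum expansion_term_power prod.distrib of_int_prod)
next
  fix f :: "nat \<Rightarrow> nat" and n l k
  assume "(\<Sum>n | f n \<noteq> 0. (int (f n) * \<nu> n, int (f n) * l0, int (f n) * k0)) = (n, l, k)"
  hence n: "n = (\<Sum>n | f n \<noteq> 0. int (f n) * \<nu> n)" and k: "k = (\<Sum>n | f n \<noteq> 0. int (f n) * k0)"
    by (simp_all add: prod_eq_iff fst_sum snd_sum)
  have "n + k = (\<Sum>n | f n \<noteq> 0. int (f n) * (\<nu> n + k0))"
    by (simp add: n k sum.distrib[symmetric] distrib_left)
  thus "0 \<le> n \<and> 0 \<le> n + k"
    using \<nu> by (auto simp: n intro!: sum_nonneg)
qed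

lemma norm_expansion_term_geometric:
  "norm (expansion_term \<tau> z x (n0 + int n, l, k)) =
     norm (expansion_term \<tau> z x (n0, l, k)) * norm (e2pi \<tau>) ^ n"
  by (simp add: expansion_term_def power_int_add norm_mult norm_power mult_ac)

lemma expansion_term_geometric:
  "expansion_term \<tau> z x (n0 + int n, l, k) = expansion_term \<tau> z x (n0, l, k) * e2pi \<tau> ^ n"
  by (simp add: expansion_term_def power_int_add mult_ac)

section \<open>The Euler product\<close>

text \<open>
  The q-Pochhammer symbol \<open>(u; q)\<^sub>\<infinity>\<close>.
\<close>

definition euler_prod :: "complex \<Rightarrow> complex \<Rightarrow> complex" where
  "euler_prod q u = (\<Prod>n. 1 - u * q ^ n)"

lemma convergent_euler_prod:
  fixes q u :: complex
  assumes "norm q < 1"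
  shows "convergent_prod (\<lambda>n. 1 - u * q ^ n)"
proof (intro abs_convergent_prod_imp_convergent_prod summable_imp_abs_convergent_prod)
  have "summable (\<lambda>n. norm u * norm q ^ n)"
    using assms by (intro summable_mult summable_geometric) simp
  thus "summable (\<lambda>n. norm (1 - u * q ^ n - 1))"
    by (simp add: norm_mult norm_power)
qed

lemma euler_prod_tendsto:
  assumes "norm q < 1"
  shows "(\<lambda>N. \<Prod>n<N. 1 - u * q ^ n) \<longlonglongrightarrow> euler_prod q u"
  using convergent_prod_LIMSEQ[OF convergent_euler_prod[OF assms, of u]]
  unfolding euler_prod_def lessThan_Suc_atMost[symmetric] by (rule LIMSEQ_imp_Suc)

lemma euler_prod_rec:
  assumes "norm q < 1"
  shows "euler_prod q u = (1 - u) * euler_prod q (u * q)"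
proof (rule LIMSEQ_unique)
  show "(\<lambda>N. \<Prod>n<Suc N. 1 - u * q ^ n) \<longlonglongrightarrow> euler_prod q u"
    by (rule LIMSEQ_Suc[OF euler_prod_tendsto[OF assms]])
  have "(\<lambda>N. (1 - u) * (\<Prod>n<N. 1 - (u * q) * q ^ n)) \<longlonglongrightarrow> (1 - u) * euler_prod q (u * q)"
    by (intro tendsto_mult tendsto_const euler_prod_tendsto assms)
  thus "(\<lambda>N. \<Prod>n<Suc N. 1 - u * q ^ n) \<longlonglongrightarrow> (1 - u) * euler_prod q (u * q)"
    by (simp add: prod.lessThan_Suc_shift mult.assoc del: prod.lessThan_Suc)
qed

lemma euler_prod_nonzero:
  assumes "norm q < 1" "norm u < 1"
  shows "euler_prod q u \<noteq> 0"
  unfolding euler_prod_def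
proof (rule prodinf_nonzero[OF convergent_euler_prod[OF assms(1)]])
  fix n
  have "norm (u * q ^ n) \<le> norm u * 1"
    unfolding norm_mult norm_power
    using assms by (intro mult_left_mono power_le_one) auto
  hence "u * q ^ n \<noteq> 1" using assms(2) by force
  thus "1 - u * q ^ n \<noteq> 0" by simp
qed

lemma integral_expansion_euler_prod:
  assumes "0 \<le> n0" "0 \<le> n0 + k"
  shows "integral_expansion (\<lambda>\<tau> z x. euler_prod (e2pi \<tau>) (expansion_term \<tau> z x (n0, l, k)))"
proof (rule integral_expansion_infinite_product[where
      s = "\<lambda>j. if j = 0 then 1 else if j = 1 then -1 else 0" and \<nu> = "\<lambda>n. n0 + int n" and
      V = "\<lambda>\<tau> z x n. 1 - expansion_term \<tau> z x (n0, l, k) * e2pi \<tau> ^ n" and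
      \<epsilon> = "\<lambda>\<tau> z x n. norm (expansion_term \<tau> z x (n0, l, k)) * norm (e2pi \<tau>) ^ n"])
  fix \<tau> z x n assume reg: "norm (e2pi \<tau>) < norm (e2pi x)" "norm (e2pi x) < 1"
  let ?W = "expansion_term \<tau> z x (n0 + int n, l, k)"
  show "((\<lambda>j. of_int (if j = 0 then 1 else if j = 1 then -1 else 0) * ?W ^ j) has_sum
          1 - expansion_term \<tau> z x (n0, l, k) * e2pi \<tau> ^ n) (UNIV :: nat set)"
    by (rule has_sum_finite_neutralI[of "{0, 1}"]) (auto simp: expansion_term_geometric)
  show "((\<lambda>j. norm (of_int (if j = 0 then 1 else if j = 1 then -1 else 0) * ?W ^ j)) has_sum
          1 + norm (expansion_term \<tau> z x (n0, l, k)) * norm (e2pi \<tau>) ^ n) (UNIV :: nat set)"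
    by (rule has_sum_finite_neutralI[of "{0, 1}"]) (auto simp: norm_expansion_term_geometric)
next
  fix \<tau> z x assume reg: "norm (e2pi \<tau>) < norm (e2pi x)" "norm (e2pi x) < 1"
  show "summable (\<lambda>n. norm (expansion_term \<tau> z x (n0, l, k)) * norm (e2pi \<tau>) ^ n)"
    using reg by (intro summable_mult summable_geometric) auto
  show "(\<lambda>N. \<Prod>n<N. 1 - expansion_term \<tau> z x (n0, l, k) * e2pi \<tau> ^ n) \<longlonglongrightarrow>
          euler_prod (e2pi \<tau>) (expansion_term \<tau> z x (n0, l, k))"
    using reg by (intro euler_prod_tendsto) auto
qed (use assms in auto)

lemma has_sum_geometric:
  fixes w :: "'a :: {real_normed_field, banach}"
  assumes "norm w < 1"
  shows "((\<lambda>j. w ^ j) has_sum 1 / (1 - w)) UNIV"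
  using assms by (intro norm_summable_imp_has_sum geometric_sums) (auto simp: norm_power intro!: summable_geometric)

text \<open>
  Here the factors are geometric series; their absolute values sum to 1 + w/(1 - w), where w is the
  absolute value of the monomial.
\<close>

lemma integral_expansion_inverse_euler_prod:
  assumes "0 \<le> n0" "0 \<le> n0 + k"
    and small: "\<And>\<tau> z x. norm (e2pi \<tau>) < norm (e2pi x) \<Longrightarrow> norm (e2pi x) < 1 \<Longrightarrow>
      norm (expansion_term \<tau> z x (n0, l, k)) < 1"
  shows "integral_expansion (\<lambda>\<tau> z x. inverse (euler_prod (e2pi \<tau>) (expansion_term \<tau> z x (n0, l, k))))"
proof (rule integral_expansion_infinite_product[where
      s = "\<lambda>j. 1" and \<nu> = "\<lambda>n. n0 + int n" and
      V = "\<lambda>\<tau> z x n. inverse (1 - expansion_term \<tau> z x (n0, l, k) * e2pi \<tau> ^ n)" and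
      \<epsilon> = "\<lambda>\<tau> z x n. norm (expansion_term \<tau> z x (n0 + int n, l, k)) /
                         (1 - norm (expansion_term \<tau> z x (n0 + int n, l, k)))"])
  fix \<tau> z x assume reg: "norm (e2pi \<tau>) < norm (e2pi x)" "norm (e2pi x) < 1"
  let ?w = "norm (expansion_term \<tau> z x (n0, l, k))"
  have le: "norm (expansion_term \<tau> z x (n0 + int n, l, k)) \<le> ?w" for n
    unfolding norm_expansion_term_geometric using reg by (intro mult_left_le power_le_one) auto
  have lt: "norm (expansion_term \<tau> z x (n0 + int n, l, k)) < 1" for n
    using le[of n] small[OF reg, of z] by simp
  {
    fix n
    show "((\<lambda>j. of_int 1 * expansion_term \<tau> z x (n0 + int n, l, k) ^ j) has_sum
            inverse (1 - expansion_term \<tau> z x (n0, l, k) * e2pi \<tau> ^ n)) UNIV"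
      using has_sum_geometric[OF lt[of n]] by (simp add: expansion_term_geometric divide_inverse)
    have "norm (norm (expansion_term \<tau> z x (n0 + int n, l, k))) < 1"
      using lt[of n] by simp
    from has_sum_geometric[OF this]
    show "((\<lambda>j. norm (of_int 1 * expansion_term \<tau> z x (n0 + int n, l, k) ^ j)) has_sum
            1 + norm (expansion_term \<tau> z x (n0 + int n, l, k)) /
               (1 - norm (expansion_term \<tau> z x (n0 + int n, l, k)))) UNIV"
      using lt[of n] by (simp add: norm_power field_simps)
    show "0 \<le> norm (expansion_term \<tau> z x (n0 + int n, l, k)) /
               (1 - norm (expansion_term \<tau> z x (n0 + int n, l, k)))"
      using lt[of n] by simp
  }
  show "summable (\<lambda>n. norm (expansion_term \<tau> z x (n0 + int n, l, k)) /
               (1 - norm (expansion_term \<tau> z x (n0 + int n, l, k))))"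
  proof (rule summable_comparison_test)
    show "summable (\<lambda>n. ?w / (1 - ?w) * norm (e2pi \<tau>) ^ n)"
      using reg by (intro summable_mult summable_geometric) auto
    show "\<exists>N. \<forall>n\<ge>N. norm (norm (expansion_term \<tau> z x (n0 + int n, l, k)) /
               (1 - norm (expansion_term \<tau> z x (n0 + int n, l, k)))) \<le> ?w / (1 - ?w) * norm (e2pi \<tau>) ^ n"
    proof (intro exI allI impI)
      fix n
      have "norm (norm (expansion_term \<tau> z x (n0 + int n, l, k)) /
               (1 - norm (expansion_term \<tau> z x (n0 + int n, l, k)))) =
            norm (expansion_term \<tau> z x (n0 + int n, l, k)) /
               (1 - norm (expansion_term \<tau> z x (n0 + int n, l, k)))"
        using lt[of n] by simp
      also have "\<dots> \<le> norm (expansion_term \<tau> z x (n0 + int n, l, k)) / (1 - ?w)"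
        using lt[of n] le[of n] small[OF reg, of z] by (intro divide_left_mono mult_pos_pos) auto
      finally show "norm (norm (expansion_term \<tau> z x (n0 + int n, l, k)) /
               (1 - norm (expansion_term \<tau> z x (n0 + int n, l, k)))) \<le> ?w / (1 - ?w) * norm (e2pi \<tau>) ^ n"
        by (simp add: norm_expansion_term_geometric)
    qed
  qed
  have "(\<lambda>N. inverse (\<Prod>n<N. 1 - expansion_term \<tau> z x (n0, l, k) * e2pi \<tau> ^ n)) \<longlonglongrightarrow>
          inverse (euler_prod (e2pi \<tau>) (expansion_term \<tau> z x (n0, l, k)))"
    using reg small[OF reg, of z]
    by (intro tendsto_inverse euler_prod_tendsto euler_prod_nonzero) auto
  thus "(\<lambda>N. \<Prod>n<N. inverse (1 - expansion_term \<tau> z x (n0, l, k) * e2pi \<tau> ^ n)) \<longlonglongrightarrow>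
          inverse (euler_prod (e2pi \<tau>) (expansion_term \<tau> z x (n0, l, k)))"
    by (simp only: prod_inversef[symmetric] o_def)
qed (use assms in auto)

section \<open>The elliptic genus\<close>

lemma Phi0_eq_euler_prods:
  fixes \<tau> z x :: complex
  defines "q \<equiv> e2pi \<tau>" and "y \<equiv> e2pi z" and "t \<equiv> e2pi x"
  assumes reg: "norm q < 1"
  shows "Phi0 \<tau> z x = inverse y *
     (euler_prod q (y * t) * euler_prod q (inverse y * q * inverse t) *
      euler_prod q (y * inverse t) * euler_prod q (inverse y * q * t) /
      (euler_prod q t * euler_prod q (q * inverse t) *
       euler_prod q (inverse t) * euler_prod q (q * t)))"
proof -
  note conv = convergent_euler_prod[OF reg]
  have "Phi0 \<tau> z x = inverse y * (\<Prod>n.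
       ((1 - (y * t) * q ^ n) * (1 - (inverse y * q * inverse t) * q ^ n) *
        (1 - (y * inverse t) * q ^ n) * (1 - (inverse y * q * t) * q ^ n)) /
       ((1 - t * q ^ n) * (1 - (q * inverse t) * q ^ n) *
        (1 - inverse t * q ^ n) * (1 - (q * t) * q ^ n)))"
    by (simp add: Phi0_def Let_def q_def y_def t_def mult_ac)
  also have "(\<Prod>n.
       ((1 - (y * t) * q ^ n) * (1 - (inverse y * q * inverse t) * q ^ n) *
        (1 - (y * inverse t) * q ^ n) * (1 - (inverse y * q * t) * q ^ n)) /
       ((1 - t * q ^ n) * (1 - (q * inverse t) * q ^ n) *
        (1 - inverse t * q ^ n) * (1 - (q * t) * q ^ n))) =
     euler_prod q (y * t) * euler_prod q (inverse y * q * inverse t) *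
      euler_prod q (y * inverse t) * euler_prod q (inverse y * q * t) /
      (euler_prod q t * euler_prod q (q * inverse t) *
       euler_prod q (inverse t) * euler_prod q (q * t))"
    unfolding euler_prod_def
    by (simp only: prodinf_divide[symmetric] prodinf_mult conv convergent_prod_mult)
  finally show ?thesis .
qed

lemma integral_expansion_one_minus_t_over_y:
  "integral_expansion (\<lambda>\<tau> z x. 1 - inverse (e2pi z) * e2pi x)"
proof (rule integral_expansionI)
  fix \<tau> z x
  show "((\<lambda>v. of_int (if v = (0, 0, 0) then 1 else -1) * expansion_term \<tau> z x v) has_sum
          1 - inverse (e2pi z) * e2pi x) {(0, 0, 0), (0, -1, 1)}"
    by (rule has_sum_finiteI) (auto simp: expansion_term_def)
qed auto

lemma integral_expansion_geometric_t:
  "integral_expansion (\<lambda>\<tau> z x. 1 / (1 - e2pi x))"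
proof (rule integral_expansionI)
  fix \<tau> z x :: complex assume "norm (e2pi x) < 1"
  from has_sum_geometric[OF this]
  show "((\<lambda>j. of_int 1 * expansion_term \<tau> z x (0, 0, int j)) has_sum 1 / (1 - e2pi x)) UNIV"
    by (simp add: expansion_term_def)
qed auto

text \<open>
  The factors 1 - y/t and 1 - 1/t violate the support condition, and 1/(1 - 1/t) does not expand in
  powers of 1/t where t is small. Together they are harmless:
  y^{-1} (1 - y/t) / (1 - 1/t) = (1 - t/y) / (1 - t). All remaining Euler products start at monomials
  that satisfy it.
\<close>

lemma Phi0_factorization:
  fixes \<tau> z x :: complex
  assumes reg: "norm (e2pi \<tau>) < norm (e2pi x)" "norm (e2pi x) < 1"
  defines "P \<equiv> \<lambda>v. euler_prod (e2pi \<tau>) (expansion_term \<tau> z x v)"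
  shows "Phi0 \<tau> z x = (1 - inverse (e2pi z) * e2pi x) * (1 / (1 - e2pi x)) *
     (P (0, 1, 1) * P (1, -1, -1) * P (1, 1, -1) * P (1, -1, 1)) *
     (inverse (P (0, 0, 1)) * inverse (P (1, 0, -1)) * inverse (P (1, 0, -1)) * inverse (P (1, 0, 1)))"
proof -
  define q y t where "q = e2pi \<tau>" and "y = e2pi z" and "t = e2pi x"
  have q: "norm q < 1" using reg by (simp add: q_def)
  have t: "t \<noteq> 0" "1 - t \<noteq> 0" "y \<noteq> 0" using reg by (auto simp: t_def y_def)
  have P: "P (0, 1, 1) = euler_prod q (y * t)"
    "P (1, -1, -1) = euler_prod q (inverse y * q * inverse t)"
    "P (1, 1, -1) = euler_prod q (y * inverse t * q)"
    "P (1, -1, 1) = euler_prod q (inverse y * q * t)"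
    "P (0, 0, 1) = euler_prod q t"
    "P (1, 0, -1) = euler_prod q (q * inverse t)"
    "P (1, 0, 1) = euler_prod q (q * t)"
    by (simp_all add: P_def expansion_term_def q_def y_def t_def mult_ac)
  have 1: "euler_prod q (y * inverse t) = (1 - y * inverse t) * euler_prod q (y * inverse t * q)"
    by (rule euler_prod_rec[OF q])
  have 2: "euler_prod q (inverse t) = (1 - inverse t) * euler_prod q (q * inverse t)"
    using euler_prod_rec[OF q, of "inverse t"] by (simp add: mult.commute)
  have 3: "inverse y * (1 - y * inverse t) / (1 - inverse t) = (1 - inverse y * t) * (1 / (1 - t))"
    using t by (simp add: divide_simps) (simp add: algebra_simps)
  have "Phi0 \<tau> z x = inverse y *
     (euler_prod q (y * t) * euler_prod q (inverse y * q * inverse t) *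
      ((1 - y * inverse t) * euler_prod q (y * inverse t * q)) * euler_prod q (inverse y * q * t) /
      (euler_prod q t * euler_prod q (q * inverse t) *
       ((1 - inverse t) * euler_prod q (q * inverse t)) * euler_prod q (q * t)))"
    using Phi0_eq_euler_prods[OF q[unfolded q_def], of z x] unfolding q_def[symmetric] y_def[symmetric] t_def[symmetric] 1 2 .
  also have "\<dots> = (inverse y * (1 - y * inverse t) / (1 - inverse t)) *
     (P (0, 1, 1) * P (1, -1, -1) * P (1, 1, -1) * P (1, -1, 1)) *
     (inverse (P (0, 0, 1)) * inverse (P (1, 0, -1)) * inverse (P (1, 0, -1)) * inverse (P (1, 0, 1)))"
    unfolding P divide_inverse inverse_mult_distrib by (simp only: mult_ac)
  finally show ?thesis unfolding 3 unfolding y_def t_def .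
qed

lemma has_expansion_cong:
  assumes "\<And>\<tau> z x. norm (e2pi \<tau>) < norm (e2pi x) ^ N \<Longrightarrow> norm (e2pi x) < 1 \<Longrightarrow> f \<tau> z x = g \<tau> z x"
  shows "has_expansion N f a \<longleftrightarrow> has_expansion N g a"
  using assms unfolding has_expansion_def by auto

lemma integral_expansion_Phi0: "integral_expansion Phi0"
proof -
  let ?P = "\<lambda>v \<tau> z x. euler_prod (e2pi \<tau>) (expansion_term \<tau> z x v)"
  have "norm (e2pi \<tau>) * inverse (norm (e2pi x)) < 1" if "norm (e2pi \<tau>) < norm (e2pi x)" for \<tau> x
    using that by (simp add: field_simps)
  moreover have "norm (e2pi \<tau>) * norm (e2pi x) < 1" if "norm (e2pi \<tau>) < norm (e2pi x)" "norm (e2pi x) < 1" for \<tau> x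
    using that mult_strict_mono[of "norm (e2pi \<tau>)" 1 "norm (e2pi x)" 1] by simp
  ultimately have "integral_expansion (\<lambda>\<tau> z x. (1 - inverse (e2pi z) * e2pi x) * (1 / (1 - e2pi x)) *
     (?P (0, 1, 1) \<tau> z x * ?P (1, -1, -1) \<tau> z x * ?P (1, 1, -1) \<tau> z x * ?P (1, -1, 1) \<tau> z x) *
     (inverse (?P (0, 0, 1) \<tau> z x) * inverse (?P (1, 0, -1) \<tau> z x) *
      inverse (?P (1, 0, -1) \<tau> z x) * inverse (?P (1, 0, 1) \<tau> z x)))"
    by (intro integral_expansion_mult integral_expansion_one_minus_t_over_y
          integral_expansion_geometric_t integral_expansion_euler_prod
          integral_expansion_inverse_euler_prod)
       (auto simp: expansion_term_def norm_mult norm_inverse)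
  thus ?thesis
    unfolding integral_expansion_def
    by (subst has_expansion_cong[where g = "\<lambda>\<tau> z x. (1 - inverse (e2pi z) * e2pi x) * (1 / (1 - e2pi x)) *
     (?P (0, 1, 1) \<tau> z x * ?P (1, -1, -1) \<tau> z x * ?P (1, 1, -1) \<tau> z x * ?P (1, -1, 1) \<tau> z x) *
     (inverse (?P (0, 0, 1) \<tau> z x) * inverse (?P (1, 0, -1) \<tau> z x) *
      inverse (?P (1, 0, -1) \<tau> z x) * inverse (?P (1, 0, 1) \<tau> z x))"])
       (simp_all only: power_one_right Phi0_factorization)
qed

section \<open>The elliptic transformation law\<close>

text \<open>
  Theta functions change by a monomial under a shift of the argument by a period. The proof does not
  divide by 1 - u, so zeros of the product are covered.
\<close>

lemma euler_prod_reflect: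
  assumes "norm q < 1" "u \<noteq> 0"
  shows "euler_prod q (u * q) * euler_prod q (inverse u) =
           - inverse u * (euler_prod q u * euler_prod q (inverse u * q))"
proof -
  have "euler_prod q (u * q) * euler_prod q (inverse u) =
          euler_prod q (u * q) * ((1 - inverse u) * euler_prod q (inverse u * q))"
    using euler_prod_rec[OF assms(1), of "inverse u"] by simp
  also have "1 - inverse u = - inverse u * (1 - u)"
    using assms(2) by (simp add: algebra_simps)
  also have "euler_prod q (u * q) * (- inverse u * (1 - u) * euler_prod q (inverse u * q)) =
      - inverse u * ((1 - u) * euler_prod q (u * q) * euler_prod q (inverse u * q))"
    by (simp only: mult_ac)
  finally show ?thesis unfolding euler_prod_rec[OF assms(1), of u, symmetric] .
qed

text \<open>
  The numerator consists of two theta functions, in yt and in y/t, whose factors combine to the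
  automorphy factor of a Jacobi form of index 1.
\<close>

lemma Phi0_elliptic_shift:
  assumes "norm (e2pi \<tau>) < 1"
  shows "Phi0 \<tau> z x = e2pi \<tau> * e2pi z ^ 2 * Phi0 \<tau> (z + \<tau>) x"
proof -
  define q y t where "q = e2pi \<tau>" and "y = e2pi z" and "t = e2pi x"
  have nz: "q \<noteq> 0" "y \<noteq> 0" "t \<noteq> 0" by (simp_all add: q_def y_def t_def)
  have q: "norm q < 1" using assms by (simp add: q_def)
  have y': "e2pi (z + \<tau>) = y * q" by (simp add: e2pi_add y_def q_def)
  let ?D = "euler_prod q t * euler_prod q (q * inverse t) * euler_prod q (inverse t) * euler_prod q (q * t)"
  have inv: "inverse (y * q) * q = inverse y" using nz by simp
  have gen: "inverse (y * q) * ((- inverse (y * t) * A) * (- (inverse y * t) * B) / D) =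
               inverse (y * q) * inverse (y ^ 2) * (A * B / D)"
       "q * y ^ 2 * (inverse (y * q) * inverse (y ^ 2) * A) = inverse y * A" for A B D
    using nz by (simp_all add: divide_simps power2_eq_square)
  have r1: "euler_prod q (y * q * t) * euler_prod q (inverse (y * q) * q * inverse t) =
      - inverse (y * t) * (euler_prod q (y * t) * euler_prod q (inverse y * q * inverse t))"
    using euler_prod_reflect[OF q, of "y * t"] nz unfolding inv by (simp add: mult_ac)
  have r2: "euler_prod q (y * q * inverse t) * euler_prod q (inverse (y * q) * q * t) =
      - (inverse y * t) * (euler_prod q (y * inverse t) * euler_prod q (inverse y * q * t))"
    using euler_prod_reflect[OF q, of "y * inverse t"] nz unfolding inv by (simp add: mult_ac)
  let ?A = "euler_prod q (y * t) * euler_prod q (inverse y * q * inverse t)"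
  let ?B = "euler_prod q (y * inverse t) * euler_prod q (inverse y * q * t)"
  have "Phi0 \<tau> (z + \<tau>) x = inverse (y * q) *
     ((euler_prod q (y * q * t) * euler_prod q (inverse (y * q) * q * inverse t)) *
      (euler_prod q (y * q * inverse t) * euler_prod q (inverse (y * q) * q * t)) / ?D)"
    using Phi0_eq_euler_prods[OF assms, of "z + \<tau>" x]
    unfolding y' q_def[symmetric] t_def[symmetric] by (simp only: mult.assoc)
  hence 1: "Phi0 \<tau> (z + \<tau>) x = inverse (y * q) * inverse (y ^ 2) * (?A * ?B / ?D)"
    unfolding r1 r2 gen(1) .
  have 2: "Phi0 \<tau> z x = inverse y * (?A * ?B / ?D)"
    using Phi0_eq_euler_prods[OF assms, of z x]
    unfolding q_def[symmetric] y_def[symmetric] t_def[symmetric] by (simp only: mult.assoc)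
  show ?thesis
    unfolding 2 unfolding 1 q_def[symmetric] y_def[symmetric] gen(2) ..
qed

lemma Phi0_coeff_shift:
  assumes a: "has_expansion 1 Phi0 a"
  shows "a (n + l + 1) (l + 2) k = a n l k"
proof -
  have "has_expansion 1 Phi0 (\<lambda>n l k. a (n - l + 1) (l - 2) k)"
    unfolding has_expansion_altdef
  proof (intro allI impI)
    fix \<tau> z x assume reg: "norm (e2pi \<tau>) < norm (e2pi x) ^ 1 \<and> norm (e2pi x) < 1"
    hence q: "norm (e2pi \<tau>) < 1" by simp
    have "((\<lambda>(n, l, k). a n l k * expansion_term \<tau> (z + \<tau>) x (n, l, k)) has_sum Phi0 \<tau> (z + \<tau>) x) UNIV"
      using a reg unfolding has_expansion_altdef by blast
    hence "((\<lambda>v. e2pi \<tau> * e2pi z ^ 2 * (case v of (n, l, k) \<Rightarrow> a n l k * expansion_term \<tau> (z + \<tau>) x (n, l, k)))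
             has_sum e2pi \<tau> * e2pi z ^ 2 * Phi0 \<tau> (z + \<tau>) x) UNIV"
      by (rule has_sum_cmult_right)
    also have "?this \<longleftrightarrow> ((\<lambda>(n, l, k). a (n - l + 1) (l - 2) k * expansion_term \<tau> z x (n, l, k))
                   has_sum e2pi \<tau> * e2pi z ^ 2 * Phi0 \<tau> (z + \<tau>) x) UNIV"
    proof (rule has_sum_reindex_bij_witness[of _ "\<lambda>(n, l, k). (n - l + 1, l - 2, k)"
          "\<lambda>(n, l, k). (n + l + 1, l + 2, k)"])
      fix v :: "int \<times> int \<times> int"
      obtain n l k where v: "v = (n, l, k)" by (cases v)
      have "expansion_term \<tau> z x (n + l + 1, l + 2, k) =
              e2pi \<tau> * e2pi z ^ 2 * expansion_term \<tau> (z + \<tau>) x (n, l, k)"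
        by (simp add: expansion_term_def e2pi_add power_int_add power_int_mult_distrib mult_ac)
      thus "(case case v of (n, l, k) \<Rightarrow> (n + l + 1, l + 2, k) of (n, l, k) \<Rightarrow>
                a (n - l + 1) (l - 2) k * expansion_term \<tau> z x (n, l, k)) =
            e2pi \<tau> * e2pi z ^ 2 * (case v of (n, l, k) \<Rightarrow> a n l k * expansion_term \<tau> (z + \<tau>) x (n, l, k))"
        by (simp add: v)
    qed auto
    finally show "((\<lambda>(n, l, k). a (n - l + 1) (l - 2) k * expansion_term \<tau> z x (n, l, k)) has_sum Phi0 \<tau> z x) UNIV"
      using Phi0_elliptic_shift[OF q, of z x] by simp
  qed
  hence "(\<lambda>n l k. a (n - l + 1) (l - 2) k) = a"
    by (rule has_expansion_unique[OF _ a])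
  from fun_cong[OF fun_cong[OF fun_cong[OF this, of "n + l + 1"], of "l + 2"], of k]
  show ?thesis by simp
qed

lemma Phi0_coeff_shift_iterate:
  assumes a: "has_expansion 1 Phi0 a"
  shows "a n (l + 2 * j) k = a (n - j * l - j\<^sup>2) l k"
proof -
  have nat: "a n (l + 2 * int i) k = a (n - int i * l - (int i)\<^sup>2) l k" for i n l
  proof (induction i arbitrary: n)
    case (Suc i)
    have "a n (l + 2 * int (Suc i)) k = a (n - (l + 2 * int i) - 1) (l + 2 * int i) k"
      using Phi0_coeff_shift[OF a, of "n - (l + 2 * int i) - 1" "l + 2 * int i" k]
      by (simp add: algebra_simps)
    also have "\<dots> = a (n - (l + 2 * int i) - 1 - int i * l - (int i)\<^sup>2) l k"
      by (rule Suc.IH)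
    finally show ?case by (simp add: power2_eq_square algebra_simps)
  qed simp
  show ?thesis
  proof (cases "j \<ge> 0")
    case True
    thus ?thesis using nat[of n l "nat j"] by simp
  next
    case False
    define i where "i = nat (- j)"
    have j: "j = - int i" using False by (simp add: i_def)
    show ?thesis
      using nat[of "n - j * l - j\<^sup>2" "l + 2 * j" i]
      by (simp add: j power2_eq_square algebra_simps)
  qed
qed

text \<open>
  Discriminants that agree force l and l' to have the same parity, so finitely many shifts of l by 2
  lead from one to the other.
\<close>

lemma Phi0_coeff_discriminant:
  assumes a: "has_expansion 1 Phi0 a" and D: "4 * n - l\<^sup>2 = 4 * n' - l'\<^sup>2"
  shows "a n l k = a n' l' k"
proof -
  have "l\<^sup>2 - l'\<^sup>2 = 2 * (2 * n - 2 * n')" using D by simp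
  hence "even (l\<^sup>2 - l'\<^sup>2)" by simp
  hence even: "even (l - l')" by simp
  define j where "j = (l - l') div 2"
  have j: "l = l' + 2 * j" using even by (simp add: j_def)
  have cancel: "X = n'" if "4 * X = 4 * n'" for X :: int
    using that by simp
  have "n - j * l' - j\<^sup>2 = n'"
    by (rule cancel) (use D in \<open>simp add: j power2_eq_square algebra_simps\<close>)
  thus ?thesis
    using Phi0_coeff_shift_iterate[OF a, of n l' j k] by (simp add: j)
qed

text \<open>
  The discriminant is of the form 4n - l^2 for many pairs (n, l), of which any may be used to define c.
\<close>

lemma Phi0_coeff_exists:
  "\<exists>c :: int \<Rightarrow> int \<Rightarrow> int.
     ((\<forall>D k. (\<nexists>n l. n \<ge> 0 \<and> D = 4 * n - l\<^sup>2) \<longrightarrow> c D k = 0) \<and>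
      has_expansion 1 Phi0 (\<lambda>n l k. if n \<ge> 0 then of_int (c (4 * n - l\<^sup>2) k) else 0)) \<and>
     (\<forall>n l k. c (4 * n - l\<^sup>2) k \<noteq> 0 \<longrightarrow> 0 \<le> n \<and> 0 \<le> n + k)"
proof -
  obtain a :: "int \<Rightarrow> int \<Rightarrow> int \<Rightarrow> int" where
    a: "has_expansion 1 Phi0 (\<lambda>n l k. of_int (a n l k))" and
    supp: "\<And>n l k. a n l k \<noteq> 0 \<Longrightarrow> 0 \<le> n \<and> 0 \<le> n + k"
    using integral_expansion_Phi0 unfolding integral_expansion_def by blast
  define P where "P D p \<longleftrightarrow> D = 4 * fst p - (snd p)\<^sup>2" for D and p :: "int \<times> int"
  define c where "c D k = (if \<exists>p. P D p then (let p = SOME p. P D p in a (fst p) (snd p) k) else 0)" for D k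
  have c: "c (4 * n - l\<^sup>2) k = a n l k" for n l k
  proof -
    define p where "p = (SOME p. P (4 * n - l\<^sup>2) p)"
    have ex: "P (4 * n - l\<^sup>2) (n, l)" by (simp add: P_def)
    hence "P (4 * n - l\<^sup>2) p" unfolding p_def by (rule someI)
    hence "(of_int (a n l k) :: complex) = of_int (a (fst p) (snd p) k)"
      by (intro Phi0_coeff_discriminant[OF a]) (simp add: P_def)
    moreover have "c (4 * n - l\<^sup>2) k = a (fst p) (snd p) k"
      using ex unfolding c_def p_def Let_def by (subst if_P) blast+
    ultimately show ?thesis by simp
  qed
  show ?thesis
  proof (intro exI[of _ c] conjI allI impI)
    fix D k :: int assume *: "\<nexists>n l. n \<ge> 0 \<and> D = 4 * n - l\<^sup>2"
    show "c D k = 0"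
    proof (rule ccontr)
      assume nz: "c D k \<noteq> 0"
      then obtain p where "P D p" by (auto simp: c_def split: if_splits)
      hence D: "D = 4 * fst p - (snd p)\<^sup>2" by (simp add: P_def)
      with nz c have "a (fst p) (snd p) k \<noteq> 0" by simp
      with supp D * show False by blast
    qed
  next
    have "(\<lambda>n l k. if n \<ge> 0 then of_int (c (4 * n - l\<^sup>2) k) else 0) =
            (\<lambda>n l k. of_int (a n l k) :: complex)"
      using supp by (fastforce simp: c fun_eq_iff)
    thus "has_expansion 1 Phi0 (\<lambda>n l k. if n \<ge> 0 then of_int (c (4 * n - l\<^sup>2) k) else 0)"
      using a by (simp only:)
  qed (use supp c in auto)
qed

lemma
  shows has_expansion_Phi0:
      "has_expansion 1 Phi0 (\<lambda>n l k. if n \<ge> 0 then of_int (jacobi_coeff Phi0 (4 * n - l\<^sup>2) k) else 0)"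
    and jacobi_coeff_Phi0_support:
      "jacobi_coeff Phi0 (4 * n - l\<^sup>2) k \<noteq> 0 \<Longrightarrow> 0 \<le> n \<and> 0 \<le> n + k"
proof -
  from Phi0_coeff_exists obtain c :: "int \<Rightarrow> int \<Rightarrow> int" where
    c0: "((\<forall>D k. (\<nexists>n l. n \<ge> 0 \<and> D = 4 * n - l\<^sup>2) \<longrightarrow> c D k = 0) \<and>
         has_expansion 1 Phi0 (\<lambda>n l k. if n \<ge> 0 then of_int (c (4 * n - l\<^sup>2) k) else 0)) \<and>
        (\<forall>n l k. c (4 * n - l\<^sup>2) k \<noteq> 0 \<longrightarrow> 0 \<le> n \<and> 0 \<le> n + k)" ..
  note c = conjunct1[OF c0] and supp = conjunct2[OF c0, rule_format]
  have J: "jacobi_coeff Phi0 = c"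
    unfolding jacobi_coeff_def
  proof (rule the_equality)
    fix c' :: "int \<Rightarrow> int \<Rightarrow> int"
    assume c': "(\<forall>D k. (\<nexists>n l. n \<ge> 0 \<and> D = 4 * n - l\<^sup>2) \<longrightarrow> c' D k = 0) \<and>
      has_expansion 1 Phi0 (\<lambda>n l k. if n \<ge> 0 then of_int (c' (4 * n - l\<^sup>2) k) else 0)"
    have eq: "(\<lambda>n l k. if n \<ge> 0 then of_int (c' (4 * n - l\<^sup>2) k) else 0) =
          (\<lambda>n l k. if n \<ge> 0 then of_int (c (4 * n - l\<^sup>2) k) else (0 :: complex))"
      by (rule has_expansion_unique[OF conjunct2[OF c'] conjunct2[OF c]])
    show "c' = c"
    proof (intro ext)
      fix D k :: int
      show "c' D k = c D k"
      proof (cases "\<exists>n l. n \<ge> 0 \<and> D = 4 * n - l\<^sup>2")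
        case True
        then obtain n l where "n \<ge> 0" "D = 4 * n - l\<^sup>2" by blast
        thus ?thesis using fun_cong[OF fun_cong[OF fun_cong[OF eq, of n], of l], of k] by simp
      qed (simp add: conjunct1[OF c, rule_format] conjunct1[OF c', rule_format])
    qed
  qed (rule c)
  show "has_expansion 1 Phi0 (\<lambda>n l k. if n \<ge> 0 then of_int (jacobi_coeff Phi0 (4 * n - l\<^sup>2) k) else 0)"
    unfolding J by (rule conjunct2[OF c])
  show "jacobi_coeff Phi0 (4 * n - l\<^sup>2) k \<noteq> 0 \<Longrightarrow> 0 \<le> n \<and> 0 \<le> n + k"
    unfolding J by (rule supp)
qed

text \<open>
  Every discriminant is attained with l = 0 or l = 1, where the support condition n \<ge> 0 applies.
\<close>

lemma jacobi_coeff_Phi0_ge_minus_1: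
  assumes "jacobi_coeff Phi0 (4 * n - l\<^sup>2) k \<noteq> 0"
  shows "- 1 \<le> 4 * n - l\<^sup>2"
proof -
  define j where "j = l div 2"
  have "l = 2 * j \<or> l = 2 * j + 1" unfolding j_def by presburger
  hence "4 * n - l\<^sup>2 = 4 * (n - j\<^sup>2) - 0\<^sup>2 \<or> 4 * n - l\<^sup>2 = 4 * (n - j\<^sup>2 - j) - 1\<^sup>2"
    by (auto simp: power2_eq_square algebra_simps)
  thus ?thesis
  proof
    assume *: "4 * n - l\<^sup>2 = 4 * (n - j\<^sup>2) - 0\<^sup>2"
    from jacobi_coeff_Phi0_support[OF assms[unfolded *]] show ?thesis unfolding * by simp
  next
    assume *: "4 * n - l\<^sup>2 = 4 * (n - j\<^sup>2 - j) - 1\<^sup>2"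
    from jacobi_coeff_Phi0_support[OF assms[unfolded *]] show ?thesis unfolding * by simp
  qed
qed

section \<open>The logarithm of the Borcherds product\<close>

text \<open>
  One twelfth of the logarithm of \<open>BL_factor\<close>.
\<close>

definition log_term :: "nat \<times> nat \<times> int \<times> int \<Rightarrow> series4" where
  "log_term = (\<lambda>(m, n, l, k).
     of_int (jacobi_coeff Phi0 (4 * int n * int m - l\<^sup>2) k) * formal_Li1 (monomial (m, n, l, k)))"

text \<open>
  If l < -(m + n) then l^2 \<ge> (m + n + 1)^2, which exceeds 4nm + 1.
\<close>

lemma Phi0_support_in_cone:
  assumes "jacobi_coeff Phi0 (4 * int n * int m - l\<^sup>2) k \<noteq> 0"
  shows "0 \<le> k + int m * int n" "m > 0 \<or> n > 0 \<Longrightarrow> 0 \<le> l + int m + int n"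
proof -
  have *: "jacobi_coeff Phi0 (4 * (int m * int n) - l\<^sup>2) k \<noteq> 0"
    using assms by (simp add: mult_ac)
  show "0 \<le> k + int m * int n"
    using jacobi_coeff_Phi0_support[OF *] by simp
  have D: "l\<^sup>2 \<le> 4 * (int m * int n) + 1"
    using jacobi_coeff_Phi0_ge_minus_1[OF *] by simp
  assume pos: "m > 0 \<or> n > 0"
  show "0 \<le> l + int m + int n"
  proof (rule ccontr)
    assume "\<not> 0 \<le> l + int m + int n"
    hence "int m + int n + 1 \<le> - l" by simp
    hence "(int m + int n + 1)\<^sup>2 \<le> (- l)\<^sup>2" by (rule power_mono) simp
    also have "\<dots> \<le> 4 * (int m * int n) + 1" using D by simp
    finally have "(int m - int n)\<^sup>2 + 2 * (int m + int n) \<le> 0"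
      by (simp add: power2_eq_square algebra_simps)
    moreover have "0 < (int m - int n)\<^sup>2 + 2 * (int m + int n)"
      using pos by (intro add_nonneg_pos) auto
    ultimately show False by simp
  qed
qed

lemma BL_index_in_cone:
  assumes "(m, n, l, k) \<in> BL_index" "jacobi_coeff Phi0 (4 * int n * int m - l\<^sup>2) k \<noteq> 0"
  shows "in_cone (int m) (int n) l k" "1 \<le> weight (int m) (int n) l k"
proof -
  note supp = Phi0_support_in_cone[OF assms(2)]
  have l: "0 \<le> l + int m + int n"
    using supp(2) assms(1) by (cases "m > 0 \<or> n > 0") (auto simp: BL_index_def)
  thus "in_cone (int m) (int n) l k"
    using supp(1) by (simp add: in_cone_def)
  have w: "weight (int m) (int n) l k = (int m + int n) + (l + int m + int n) + (k + int m * int n)"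
    by (simp add: weight_def)
  show "1 \<le> weight (int m) (int n) l k"
  proof (cases "m > 0 \<or> n > 0")
    case True
    thus ?thesis unfolding w using l supp(1) by linarith
  next
    case False
    thus ?thesis using l supp(1) assms(1) by (auto simp: BL_index_def weight_def)
  qed
qed

lemma ord_ge_log_term:
  assumes "(m, n, l, k) \<in> BL_index"
    and "jacobi_coeff Phi0 (4 * int n * int m - l\<^sup>2) k \<noteq> 0 \<Longrightarrow> int N \<le> weight (int m) (int n) l k"
  shows "ord_ge N (log_term (m, n, l, k))"
proof (cases "jacobi_coeff Phi0 (4 * int n * int m - l\<^sup>2) k = 0")
  case False
  note * = BL_index_in_cone[OF assms(1) False]
  have "ord_ge 1 (monomial (m, n, l, k))" "ord_ge N (monomial (m, n, l, k))"
    using * assms(2)[OF False] by (auto intro!: ord_ge_monomial)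
  thus ?thesis
    unfolding log_term_def prod.case of_int_eq_const4
    by (intro ord_ge_const4_mult ord_ge_formal_Li1)
qed (simp add: log_term_def)

lemma ord_ge_1_log_term: "i \<in> BL_index \<Longrightarrow> ord_ge 1 (log_term i)"
  by (cases i) (auto intro!: ord_ge_log_term BL_index_in_cone simp del: One_nat_def)

lemma adic_family_log_term: "adic_family log_term BL_index"
  unfolding adic_family_def
proof (intro conjI ballI allI)
  show "ord_ge 0 (log_term i)" if "i \<in> BL_index" for i
    by (rule ord_ge_0_imp[OF ord_ge_1_log_term[OF that]])
  fix N
  show "finite {i \<in> BL_index. \<not> ord_ge N (log_term i)}"
  proof (rule finite_subset)
    let ?B = "{(m, n, l, k). in_cone m n l k \<and> weight m n l k \<le> int N}"
    show "finite ((\<lambda>(m, n, l, k). (nat m, nat n, l, k)) ` ?B)"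
      by (intro finite_imageI finite_cone_weight)
    show "{i \<in> BL_index. \<not> ord_ge N (log_term i)} \<subseteq> (\<lambda>(m, n, l, k). (nat m, nat n, l, k)) ` ?B"
    proof clarify
      fix m n l k assume i: "(m, n, l, k) \<in> BL_index" "\<not> ord_ge N (log_term (m, n, l, k))"
      hence "jacobi_coeff Phi0 (4 * int n * int m - l\<^sup>2) k \<noteq> 0" "weight (int m) (int n) l k < int N"
        using ord_ge_log_term by force+
      hence "(int m, int n, l, k) \<in> ?B"
        using BL_index_in_cone[OF i(1)] by auto
      thus "(m, n, l, k) \<in> (\<lambda>(m, n, l, k). (nat m, nat n, l, k)) ` ?B"
        by (rule rev_image_eqI) simp
    qed
  qed
qed

definition log_BL :: series4 where
  "log_BL = adic_sum log_term BL_index"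

lemma ord_ge_log_BL: "ord_ge 0 log_BL"
  unfolding log_BL_def using adic_family_log_term
  by (intro ord_ge_adic_sum) (auto simp: adic_family_def)

lemma BL_factor_eq_exp:
  assumes "i \<in> BL_index"
  shows "BL_factor i = formal_exp (of_nat 12 * log_term i)"
proof -
  obtain m n l k where i: "i = (m, n, l, k)" by (cases i)
  let ?c = "jacobi_coeff Phi0 (4 * int n * int m - l\<^sup>2) k"
  show ?thesis
  proof (cases "?c = 0")
    case False
    have mono: "ord_ge 1 (monomial (m, n, l, k))"
      using BL_index_in_cone[OF assms[unfolded i] False] by (intro ord_ge_monomial) simp_all
    have "BL_factor i = (1 - monomial (m, n, l, k)) powi (- (12 * ?c))"
      by (simp add: BL_factor_def i monomial_def)
    also have "\<dots> = formal_exp (of_int (12 * ?c) * formal_Li1 (monomial (m, n, l, k)))"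
      by (rule formal_exp_int_Li1[OF mono, symmetric])
    finally show ?thesis by (simp add: i log_term_def mult.assoc)
  qed (simp add: BL_factor_def i log_term_def)
qed

lemma has_formal_prod_BL_factor:
  "has_formal_prod BL_factor BL_index (formal_exp (of_nat 12 * log_BL))"
proof -
  let ?g = "\<lambda>i. const4 12 * log_term i"
  \<comment> \<open>the numeral as a scalar, so that coefficients are simply multiplied by it\<close>
  have twelve: "of_nat 12 = const4 12"
    using of_nat_eq_const4[of 12] by simp
  have coeff: "coeff4 (?g i) m n l k \<noteq> 0 \<longleftrightarrow> coeff4 (log_term i) m n l k \<noteq> 0" for i m n l k
    by (simp add: coeff4_const4_mult)
  have fam: "adic_family ?g BL_index"
    using adic_family_log_term unfolding adic_family_def ord_ge_def coeff by simp
  have "adic_sum ?g BL_index = const4 12 * log_BL"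
    unfolding log_BL_def
    by (rule series4_eqI, unfold coeff4_adic_sum[OF fam] coeff)
       (simp only: coeff4_const4_mult coeff4_adic_sum[OF adic_family_log_term] sum_distrib_left)
  hence "has_formal_prod (\<lambda>i. formal_exp (?g i)) BL_index (formal_exp (of_nat 12 * log_BL))"
    unfolding twelve
    using has_formal_prod_formal_exp[OF fam] ord_ge_1_log_term
    by (simp add: ord_ge_const4_mult del: One_nat_def)
  moreover have "(\<Prod>i\<in>F. formal_exp (?g i)) = (\<Prod>i\<in>F. BL_factor i)" if "F \<subseteq> BL_index" for F
    using that by (intro prod.cong) (auto simp: BL_factor_eq_exp[unfolded twelve])
  ultimately show ?thesis
    unfolding has_formal_prod_def eventually_finite_subsets_at_top by (simp cong: conj_cong)
qed

section \<open>The coefficients of the logarithm\<close>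

lemma coeff4_log_term:
  assumes "(m, n, l, k) \<in> BL_index"
  shows "coeff4 (log_term (m, n, l, k)) M N L K =
    of_int (jacobi_coeff Phi0 (4 * int n * int m - l\<^sup>2) k) *
    (\<Sum>j | j > 0 \<and> M = int (j * m) \<and> N = int (j * n) \<and> L = int j * l \<and> K = int j * k.
       inverse (of_nat j))"
proof (cases "jacobi_coeff Phi0 (4 * int n * int m - l\<^sup>2) k = 0")
  case False
  have "ord_ge 1 (monomial (m, n, l, k))"
    using BL_index_in_cone[OF assms False] by (intro ord_ge_monomial) simp_all
  thus ?thesis
    unfolding log_term_def prod.case of_int_eq_const4 coeff4_const4_mult
    by (subst coeff4_Li1_monomial) auto
qed (simp add: log_term_def)

lemma coeff4_log_term_nonzeroE:
  assumes "(m, n, l, k) \<in> BL_index" "coeff4 (log_term (m, n, l, k)) M N L K \<noteq> 0"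
  obtains j where "j > 0" "M = int (j * m)" "N = int (j * n)" "L = int j * l" "K = int j * k"
proof -
  have "(\<Sum>j | j > 0 \<and> M = int (j * m) \<and> N = int (j * n) \<and> L = int j * l \<and> K = int j * k.
       inverse (of_nat j :: complex)) \<noteq> 0"
    using assms(2) unfolding coeff4_log_term[OF assms(1)] by auto
  then obtain j where "j \<in> {j. j > 0 \<and> M = int (j * m) \<and> N = int (j * n) \<and> L = int j * l \<and> K = int j * k}"
    by (rule sum.not_neutral_contains_not_neutral)
  thus ?thesis by (intro that[of j]) auto
qed

definition Phi0_coeff :: "int \<Rightarrow> int \<Rightarrow> int \<Rightarrow> complex" where
  "Phi0_coeff n l k = (if n \<ge> 0 then of_int (jacobi_coeff Phi0 (4 * n - l\<^sup>2) k) else 0)"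

text \<open>
  The monomial with exponent v occurs in Li1(x) exactly if v is the a-fold exponent of x for some
  a \<ge> 1, with coefficient 1/a; since m > 0, there are finitely many such a.
\<close>

lemma coeff4_log_BL:
  assumes m: "m > 0"
  shows "coeff4 log_BL (int m) N L K =
    (\<Sum>a | a dvd m \<and> int a dvd N \<and> int a dvd L \<and> int a dvd K.
       Phi0_coeff (int (m div a) * (N div int a)) (L div int a) (K div int a) / of_nat a)"
    (is "_ = (\<Sum>a | ?D a. ?t a)")
proof (cases "N < 0")
  case True
  have zero: "?t a = 0" if "?D a" for a
  proof -
    have "a > 0" using that m by (auto intro: gr0I)
    moreover from this have "m div a > 0" using that m by (auto elim!: dvdE)
    moreover have "N div int a < 0" using True \<open>a > 0\<close> by (simp add: div_neg_pos_less0)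
    ultimately have "int (m div a) * (N div int a) < 0" by (intro mult_pos_neg) auto
    thus ?thesis by (simp add: Phi0_coeff_def)
  qed
  have "coeff4 log_BL (int m) N L K = 0"
    using True ord_geD(1)[OF ord_ge_log_BL] by (force simp: in_cone_def)
  moreover have "(\<Sum>a | ?D a. ?t a) = 0"
    by (rule sum.neutral) (use zero in blast)
  ultimately show ?thesis by simp
next
  case False
  define \<rho> where "\<rho> a = (m div a, nat (N div int a), L div int a, K div int a)" for a
  have apos: "a > 0" if "?D a" for a
    using that m by (auto intro: gr0I)
  have mpos: "m div a > 0" if "?D a" for a
    using that m by (auto elim!: dvdE)
  have inBL: "\<rho> a \<in> BL_index" if "?D a" for a
    using mpos[OF that] by (simp add: \<rho>_def BL_index_def)
  have inj: "inj_on \<rho> {a. ?D a}"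
  proof (rule inj_onI)
    fix a b assume ab: "a \<in> {a. ?D a}" "b \<in> {a. ?D a}" "\<rho> a = \<rho> b"
    hence "m div a = m div b" by (simp add: \<rho>_def)
    thus "a = b" using ab m by (auto elim!: dvdE) (metis div_mult_self1_is_m div_mult_self_is_m gr0I mult_0)
  qed
  have fin: "finite {a. ?D a}"
    by (rule finite_subset[of _ "{a. a dvd m}"]) (use m in auto)
  have coeff: "coeff4 (log_term (\<rho> a)) (int m) N L K = ?t a" if "?D a" for a
  proof -
    have N: "int (nat (N div int a)) = N div int a"
      using False apos[OF that] by (simp add: pos_imp_zdiv_nonneg_iff)
    have j: "{j. j > 0 \<and> int m = int (j * (m div a)) \<and> N = int (j * nat (N div int a)) \<and>
               L = int j * (L div int a) \<and> K = int j * (K div int a)} = {a}"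
    proof (intro equalityI subsetI)
      fix j assume "j \<in> {j. j > 0 \<and> int m = int (j * (m div a)) \<and> N = int (j * nat (N div int a)) \<and>
               L = int j * (L div int a) \<and> K = int j * (K div int a)}"
      hence "j * (m div a) = a * (m div a)" using that by (simp only: mem_Collect_eq of_nat_eq_iff) simp
      thus "j \<in> {a}" using mpos[OF that] by simp
    next
      fix j assume "j \<in> {a}"
      hence "j = a" by simp
      have N': "N = int (a * nat (N div int a))"
        using that by (simp only: of_nat_mult N) simp
      have m': "int m = int (a * (m div a))" using that by simp
      have "L = int a * (L div int a)" "K = int a * (K div int a)" using that by simp_all
      thus "j \<in> {j. j > 0 \<and> int m = int (j * (m div a)) \<and> N = int (j * nat (N div int a)) \<and>
               L = int j * (L div int a) \<and> K = int j * (K div int a)}"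
        unfolding \<open>j = a\<close> mem_Collect_eq using apos[OF that] N' m' by blast
    qed
    have nn: "0 \<le> int (m div a) * (N div int a)"
      using False apos[OF that] by (intro mult_nonneg_nonneg) (simp_all add: pos_imp_zdiv_nonneg_iff)
    show ?thesis
      unfolding \<rho>_def coeff4_log_term[OF inBL[OF that, unfolded \<rho>_def]] j N
      using nn by (simp add: Phi0_coeff_def divide_inverse mult_ac)
  qed
  let ?X = "{i \<in> BL_index. coeff4 (log_term i) (int m) N L K \<noteq> 0}"
  have "coeff4 log_BL (int m) N L K = (\<Sum>i\<in>?X. coeff4 (log_term i) (int m) N L K)"
    unfolding log_BL_def by (rule coeff4_adic_sum[OF adic_family_log_term])
  also have "\<dots> = (\<Sum>i\<in>\<rho> ` {a. ?D a}. coeff4 (log_term i) (int m) N L K)"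
  proof (rule sum.mono_neutral_left)
    show "?X \<subseteq> \<rho> ` {a. ?D a}"
    proof clarify
      fix m' n' l' k' assume *: "(m', n', l', k') \<in> BL_index"
        "coeff4 (log_term (m', n', l', k')) (int m) N L K \<noteq> 0"
      then obtain j where j: "j > 0" "int m = int (j * m')" "N = int (j * n')"
        "L = int j * l'" "K = int j * k'"
        by (rule coeff4_log_term_nonzeroE)
      have mj: "m = j * m'" using j(2) by (simp only: of_nat_eq_iff)
      have "?D j" using j(3-5) by (simp add: mj)
      moreover have "\<rho> j = (m', n', l', k')" using j(1,3-5) by (simp add: \<rho>_def mj)
      ultimately show "(m', n', l', k') \<in> \<rho> ` {a. ?D a}" by (intro rev_image_eqI[of j]) auto
    qed
    show "\<forall>i\<in>\<rho> ` {a. ?D a} - ?X. coeff4 (log_term i) (int m) N L K = 0"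
      using inBL by auto
  qed (use fin in auto)
  also have "\<dots> = (\<Sum>a | ?D a. coeff4 (log_term (\<rho> a)) (int m) N L K)"
    by (simp add: sum.reindex[OF inj])
  also have "\<dots> = (\<Sum>a | ?D a. ?t a)"
    by (intro sum.cong) (auto simp: coeff)
  finally show ?thesis .
qed

section \<open>Hecke operators on expansions\<close>

lemma e2pi_hecke_argument:
  assumes "a > 0" "d > 0"
  shows "e2pi ((of_nat a * \<tau> + of_nat b) / of_nat d) powi n =
           e2pi (of_int n * of_nat a * \<tau> / of_nat d) * e2pi (of_nat b * of_int n / of_nat d)"
proof -
  have "of_int n * ((of_nat a * \<tau> + of_nat b) / of_nat d) =
          of_int n * of_nat a * \<tau> / of_nat d + of_nat b * of_int n / (of_nat d :: complex)"
    by (simp add: add_divide_distrib distrib_left mult_ac)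
  thus ?thesis by (simp only: e2pi_of_int_mult[symmetric] e2pi_add)
qed

text \<open>
  In terms of imaginary parts the hypothesis says Im \<open>\<tau>\<close> > m Im x > 0, and the conclusion
  Im \<open>\<tau>\<close> > d Im x, where d \<le> m.
\<close>

lemma hecke_region:
  assumes "norm (e2pi \<tau>) < norm (e2pi x) ^ m" "norm (e2pi x) < 1" "a * d = m" "m > 0"
  shows "norm (e2pi ((of_nat a * \<tau> + of_nat b) / of_nat d)) < norm (e2pi (of_nat a * x))"
    "norm (e2pi (of_nat a * x)) < 1"
proof -
  have ad: "a > 0" "d > 0" "d \<le> m" using assms(3,4) by (auto intro: gr0I)
  have x: "Im x > 0" using assms(2) by (simp add: norm_e2pi zero_less_mult_iff)
  have "exp (- (2 * pi * Im \<tau>)) < exp (- (2 * pi * (real m * Im x)))"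
    using assms(1) by (simp add: norm_e2pi exp_of_nat_mult[symmetric] mult_ac)
  hence "real m * Im x < Im \<tau>" by simp
  moreover have "real d * Im x \<le> real m * Im x"
    using ad x by (intro mult_right_mono) auto
  ultimately have "real d * Im x < Im \<tau>" by linarith
  hence "Im x < Im \<tau> / real d" using ad by (simp add: field_simps)
  hence "real a * Im x < real a * (Im \<tau> / real d)"
    using ad by (intro mult_strict_left_mono) auto
  moreover have "Im ((of_nat a * \<tau> + of_nat b) / of_nat d) = real a * (Im \<tau> / real d)"
    using Im_divide_of_nat[of "of_nat a * \<tau> + of_nat b" d] by simp
  ultimately have *: "Im (of_nat a * x) < Im ((of_nat a * \<tau> + of_nat b) / of_nat d)"
    by simp
  show "norm (e2pi ((of_nat a * \<tau> + of_nat b) / of_nat d)) < norm (e2pi (of_nat a * x))"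
    unfolding norm_e2pi exp_less_cancel_iff neg_less_iff_less
    by (rule mult_strict_left_mono[OF *]) simp
  show "norm (e2pi (of_nat a * x)) < 1"
    using x ad by (simp add: norm_e2pi)
qed

text \<open>
  The sum over b is d times the projection to exponents n divisible by d; the surviving monomials
  are reindexed by (n, l, k) \<mapsto> (a n / d, a l, a k).
\<close>

lemma has_sum_hecke_summand:
  assumes f: "has_expansion 1 f A"
    and reg: "norm (e2pi \<tau>) < norm (e2pi x) ^ m" "norm (e2pi x) < 1" and ad: "a * d = m" "m > 0"
  shows "((\<lambda>(n, l, k). (if int a dvd n \<and> int a dvd l \<and> int a dvd k
             then of_nat d * A (int d * (n div int a)) (l div int a) (k div int a) else 0) *
             expansion_term \<tau> z x (n, l, k)) has_sum
          (\<Sum>b<d. f ((of_nat a * \<tau> + of_nat b) / of_nat d) (of_nat a * z) (of_nat a * x))) UNIV"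
proof -
  have pos: "a > 0" "d > 0" using ad by (auto intro: gr0I)
  let ?W = "expansion_term \<tau> z x"
  let ?F = "\<lambda>(n, l, k). if int d dvd n then of_nat d * A n l k *
              ?W (int a * (n div int d), int a * l, int a * k) else 0"
  have "((\<lambda>v. \<Sum>b<d. case v of (n, l, k) \<Rightarrow> A n l k *
            expansion_term ((of_nat a * \<tau> + of_nat b) / of_nat d) (of_nat a * z) (of_nat a * x) (n, l, k))
          has_sum (\<Sum>b<d. f ((of_nat a * \<tau> + of_nat b) / of_nat d) (of_nat a * z) (of_nat a * x))) UNIV"
  proof (rule has_sum_finite_sum)
    fix b
    show "((\<lambda>v. case v of (n, l, k) \<Rightarrow> A n l k *
            expansion_term ((of_nat a * \<tau> + of_nat b) / of_nat d) (of_nat a * z) (of_nat a * x) (n, l, k))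
          has_sum f ((of_nat a * \<tau> + of_nat b) / of_nat d) (of_nat a * z) (of_nat a * x)) UNIV"
      using f hecke_region[OF reg ad] unfolding has_expansion_altdef power_one_right by blast
  qed
  also have "(\<lambda>v. \<Sum>b<d. case v of (n, l, k) \<Rightarrow> A n l k *
            expansion_term ((of_nat a * \<tau> + of_nat b) / of_nat d) (of_nat a * z) (of_nat a * x) (n, l, k)) = ?F"
  proof
    fix v :: "int \<times> int \<times> int"
    obtain n l k where v: "v = (n, l, k)" by (cases v)
    let ?c = "A n l k * e2pi (of_nat a * z) powi l * e2pi (of_nat a * x) powi k * e2pi (of_int n * of_nat a * \<tau> / of_nat d)"
    have "(\<Sum>b<d. A n l k *
            expansion_term ((of_nat a * \<tau> + of_nat b) / of_nat d) (of_nat a * z) (of_nat a * x) (n, l, k)) =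
          ?c * (\<Sum>b<d. e2pi (of_nat b * of_int n / of_nat d))"
      unfolding sum_distrib_left expansion_term_def prod.case e2pi_hecke_argument[OF pos]
      by (intro sum.cong refl) (simp only: mult_ac)
    also have "\<dots> = (if int d dvd n then of_nat d * ?c else 0)"
      unfolding sum_roots_of_unity[OF pos(2)] by simp
    also have "\<dots> = ?F v"
    proof (cases "int d dvd n")
      case True
      then obtain n' where n: "n = int d * n'" by (elim dvdE)
      have "of_int n * of_nat a * \<tau> / of_nat d = of_int (int a * n') * \<tau>"
        using pos by (simp add: n field_simps)
      hence q: "e2pi (of_int n * of_nat a * \<tau> / of_nat d) = e2pi \<tau> powi (int a * n')"
        by (simp only: e2pi_of_int_mult)
      have pw: "e2pi (of_nat a * w) powi j = e2pi w powi (int a * j)" for w j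
        by (simp add: e2pi_of_nat_mult power_int_mult)
      show ?thesis
        unfolding v prod.case q pw expansion_term_def using pos by (simp add: n mult_ac)
    qed (simp add: v)
    finally show "(\<Sum>b<d. case v of (n, l, k) \<Rightarrow> A n l k *
            expansion_term ((of_nat a * \<tau> + of_nat b) / of_nat d) (of_nat a * z) (of_nat a * x) (n, l, k)) = ?F v"
      by (simp only: v prod.case)
  qed
  also have "(?F has_sum S) UNIV \<longleftrightarrow> (?F has_sum S) {(n, l, k). int d dvd n}" for S
    by (rule has_sum_cong_neutral) auto
  also have "(?F has_sum S) {(n, l, k). int d dvd n} \<longleftrightarrow>
     ((\<lambda>(n, l, k). (if int a dvd n \<and> int a dvd l \<and> int a dvd k
             then of_nat d * A (int d * (n div int a)) (l div int a) (k div int a) else 0) *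
             ?W (n, l, k)) has_sum S) {(n, l, k). int a dvd n \<and> int a dvd l \<and> int a dvd k}" for S
    by (rule has_sum_reindex_bij_witness[of _
          "\<lambda>(n, l, k). (int d * (n div int a), l div int a, k div int a)"
          "\<lambda>(n, l, k). (int a * (n div int d), int a * l, int a * k)"])
       (use pos in auto)
  also have "((\<lambda>(n, l, k). (if int a dvd n \<and> int a dvd l \<and> int a dvd k
             then of_nat d * A (int d * (n div int a)) (l div int a) (k div int a) else 0) *
             ?W (n, l, k)) has_sum S) {(n, l, k). int a dvd n \<and> int a dvd l \<and> int a dvd k} \<longleftrightarrow>
     ((\<lambda>(n, l, k). (if int a dvd n \<and> int a dvd l \<and> int a dvd k
             then of_nat d * A (int d * (n div int a)) (l div int a) (k div int a) else 0) *
             ?W (n, l, k)) has_sum S) UNIV" for S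
    by (rule has_sum_cong_neutral) (auto split: if_splits)
  finally show ?thesis .
qed

text \<open>
  The factor d/m of the summand for ad = m is 1/a.
\<close>

lemma has_expansion_hecke_V:
  assumes f: "has_expansion 1 f A" and m: "m > 0"
  shows "has_expansion m (hecke_V m f) (\<lambda>n l k.
     \<Sum>a | a dvd m \<and> int a dvd n \<and> int a dvd l \<and> int a dvd k.
       A (int (m div a) * (n div int a)) (l div int a) (k div int a) / of_nat a)"
  unfolding has_expansion_altdef
proof (intro allI impI)
  fix \<tau> z x assume "norm (e2pi \<tau>) < norm (e2pi x) ^ m \<and> norm (e2pi x) < 1"
  hence reg: "norm (e2pi \<tau>) < norm (e2pi x) ^ m" "norm (e2pi x) < 1" by auto
  let ?P = "{(a, d). a * d = m \<and> a > 0}"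
  let ?W = "expansion_term \<tau> z x"
  let ?s = "\<lambda>p v. case p of (a, d) \<Rightarrow> (case v of (n, l, k) \<Rightarrow>
       (if int a dvd n \<and> int a dvd l \<and> int a dvd k
        then of_nat d * A (int d * (n div int a)) (l div int a) (k div int a) else 0) * ?W (n, l, k))"
  have "((\<lambda>v. (1 / of_nat m) * (\<Sum>p\<in>?P. ?s p v)) has_sum
          (1 / of_nat m) * (\<Sum>p\<in>?P. case p of (a, d) \<Rightarrow>
             \<Sum>b<d. f ((of_nat a * \<tau> + of_nat b) / of_nat d) (of_nat a * z) (of_nat a * x))) UNIV"
    by (intro has_sum_cmult_right has_sum_finite_sum)
       (use has_sum_hecke_summand[OF f reg _ m] in \<open>auto split: prod.splits\<close>)
  also have "(1 / of_nat m) * (\<Sum>p\<in>?P. case p of (a, d) \<Rightarrow>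
             \<Sum>b<d. f ((of_nat a * \<tau> + of_nat b) / of_nat d) (of_nat a * z) (of_nat a * x)) =
       hecke_V m f \<tau> z x"
    by (simp add: hecke_V_def)
  also have "(\<lambda>v. (1 / of_nat m) * (\<Sum>p\<in>?P. ?s p v)) = (\<lambda>(n, l, k).
       (\<Sum>a | a dvd m \<and> int a dvd n \<and> int a dvd l \<and> int a dvd k.
       A (int (m div a) * (n div int a)) (l div int a) (k div int a) / of_nat a) * ?W (n, l, k))"
  proof
    fix v :: "int \<times> int \<times> int"
    obtain n l k where v: "v = (n, l, k)" by (cases v)
    let ?t = "\<lambda>a. A (int (m div a) * (n div int a)) (l div int a) (k div int a) / of_nat a * ?W (n, l, k)"
    have "(1 / of_nat m) * (\<Sum>p\<in>?P. ?s p v) =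
        (\<Sum>a | a dvd m. if int a dvd n \<and> int a dvd l \<and> int a dvd k then ?t a else 0)"
      unfolding sum_distrib_left
    proof (rule sum.reindex_bij_witness[of _ "\<lambda>a. (a, m div a)" fst])
      fix p assume p: "p \<in> ?P"
      obtain a d where ad: "p = (a, d)" by (cases p)
      have "m = a * d" "a > 0" "d > 0" using p ad m by (auto intro: gr0I)
      thus "(if int (fst p) dvd n \<and> int (fst p) dvd l \<and> int (fst p) dvd k then ?t (fst p) else 0) =
              1 / of_nat m * ?s p v"
        by (simp add: ad v)
    qed (use m in \<open>auto intro: gr0I\<close>)
    also have "\<dots> = (\<Sum>a | a dvd m \<and> int a dvd n \<and> int a dvd l \<and> int a dvd k. ?t a)"
      using m by (simp add: sum.inter_filter[symmetric] conj_ac)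
    finally show "(1 / of_nat m) * (\<Sum>p\<in>?P. ?s p v) = (case v of (n, l, k) \<Rightarrow>
       (\<Sum>a | a dvd m \<and> int a dvd n \<and> int a dvd l \<and> int a dvd k.
       A (int (m div a) * (n div int a)) (l div int a) (k div int a) / of_nat a) * ?W (n, l, k))"
      by (simp add: v sum_distrib_right)
  qed
  finally show "((\<lambda>(n, l, k).
       (\<Sum>a | a dvd m \<and> int a dvd n \<and> int a dvd l \<and> int a dvd k.
       A (int (m div a) * (n div int a)) (l div int a) (k div int a) / of_nat a) * ?W (n, l, k))
       has_sum hecke_V m f \<tau> z x) UNIV" .
qed

section \<open>The formal Borcherds lift\<close>

lemma has_expansion_hecke_V_Phi0:
  assumes "m > 0"
  shows "has_expansion m (hecke_V m Phi0)
           (\<lambda>n l k. fls_nth (fls_nth (fls_nth (fls_nth log_BL (int m)) n) l) k)"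
proof -
  have "has_expansion 1 Phi0 Phi0_coeff"
    using has_expansion_Phi0 unfolding Phi0_coeff_def[abs_def] .
  from has_expansion_hecke_V[OF this assms] show ?thesis
    unfolding coeff4_log_BL[OF assms, symmetric] coeff4_def .
qed

lemma formal_V_pos:
  assumes "m > 0"
  shows "formal_V Phi0 m = fls_const (fls_nth log_BL (int m))"
proof -
  have "(THE h :: series3. has_expansion m (hecke_V m Phi0) (\<lambda>n l k. fls_nth (fls_nth (fls_nth h n) l) k)) =
          fls_nth log_BL (int m)"
  proof (rule the_equality)
    show "has_expansion m (hecke_V m Phi0)
            (\<lambda>n l k. fls_nth (fls_nth (fls_nth (fls_nth log_BL (int m)) n) l) k)"
      by (rule has_expansion_hecke_V_Phi0[OF assms])
  next
    fix h :: series3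
    assume h: "has_expansion m (hecke_V m Phi0) (\<lambda>n l k. fls_nth (fls_nth (fls_nth h n) l) k)"
    note eq = has_expansion_unique[OF h has_expansion_hecke_V_Phi0[OF assms]]
    show "h = fls_nth log_BL (int m)"
    proof (rule fls_eqI, rule fls_eqI, rule fls_eqI)
      fix n l k
      show "fls_nth (fls_nth (fls_nth h n) l) k =
              fls_nth (fls_nth (fls_nth (fls_nth log_BL (int m)) n) l) k"
        using fun_cong[OF fun_cong[OF fun_cong[OF eq, of n], of l], of k] .
    qed
  qed
  thus ?thesis using assms by (simp add: formal_V_def)
qed

lemma coeff4_fls_const: "coeff4 (fls_const h) M n l k =
    (if M = 0 then fls_nth (fls_nth (fls_nth h n) l) k else 0)"
  by (simp add: coeff4_def)

text \<open>
  Terms with m = 0 are exactly those that contribute to the power Q^0.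
\<close>

lemma formal_V_0: "formal_V Phi0 0 = fls_const (fls_nth log_BL 0)"
proof -
  define I where "I = {(n :: nat, l :: int, k :: int). n > 0 \<or> n = 0 \<and> l > 0 \<or> n = 0 \<and> l = 0 \<and> k > 0}"
  have BL: "i \<in> I \<longleftrightarrow> (0, i) \<in> BL_index" for i
    by (auto simp: I_def BL_index_def split: prod.splits)
  have fam: "adic_family (\<lambda>i. log_term (0, i)) I"
    unfolding adic_family_def
  proof (intro conjI ballI allI)
    show "ord_ge 0 (log_term (0, i))" if "i \<in> I" for i
      using ord_ge_0_imp[OF ord_ge_1_log_term] that unfolding BL .
    fix N
    have "finite (Pair 0 -` {i \<in> BL_index. \<not> ord_ge N (log_term i)})"
      using adic_family_log_term by (intro finite_vimageI) (auto simp: adic_family_def inj_on_def)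
    moreover have "{i \<in> I. \<not> ord_ge N (log_term (0, i))} =
        Pair 0 -` {i \<in> BL_index. \<not> ord_ge N (log_term i)}"
      using BL by blast
    ultimately show "finite {i \<in> I. \<not> ord_ge N (log_term (0, i))}" by simp
  qed
  have "formal_V Phi0 0 = formal_sum (\<lambda>i. log_term (0, i)) I"
    unfolding formal_V_def log_term_def monomial_def I_def
    by (simp add: case_prod_unfold)
  also have "\<dots> = adic_sum (\<lambda>i. log_term (0, i)) I"
    by (rule formal_sum_adic[OF fam])
  also have "\<dots> = fls_const (fls_nth log_BL 0)"
  proof (rule series4_eqI)
    fix M N L K
    let ?X = "{i \<in> I. coeff4 (log_term (0, i)) M N L K \<noteq> 0}"
    have sum: "coeff4 (adic_sum (\<lambda>i. log_term (0, i)) I) M N L K =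
                 (\<Sum>i\<in>?X. coeff4 (log_term (0, i)) M N L K)"
      by (rule coeff4_adic_sum[OF fam])
    have zero: "fst i = 0 \<longleftrightarrow> M = 0"
      if "i \<in> BL_index" "coeff4 (log_term i) M N L K \<noteq> 0" for i
    proof -
      obtain m n l k where i: "i = (m, n, l, k)" by (cases i)
      from that[unfolded i] obtain j where "j > 0" "M = int (j * m)"
        by (rule coeff4_log_term_nonzeroE)
      thus ?thesis by (simp add: i)
    qed
    show "coeff4 (adic_sum (\<lambda>i. log_term (0, i)) I) M N L K =
            coeff4 (fls_const (fls_nth log_BL 0)) M N L K"
    proof (cases "M = 0")
      case False
      hence empty: "?X = {}" using zero[of "(0, _)"] BL by force
      show ?thesis unfolding sum empty using False by (simp add: coeff4_fls_const)
    next
      case True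
      have "coeff4 (fls_const (fls_nth log_BL 0)) M N L K = coeff4 log_BL M N L K"
        using True by (simp add: coeff4_def)
      also have "\<dots> = (\<Sum>i\<in>{i \<in> BL_index. coeff4 (log_term i) M N L K \<noteq> 0}. coeff4 (log_term i) M N L K)"
        unfolding log_BL_def by (rule coeff4_adic_sum[OF adic_family_log_term])
      also have "\<dots> = (\<Sum>i\<in>?X. coeff4 (log_term (0, i)) M N L K)"
      proof (rule sum.reindex_bij_witness[of _ "Pair 0" snd])
        fix i assume "i \<in> {i \<in> BL_index. coeff4 (log_term i) M N L K \<noteq> 0}"
        hence i: "i \<in> BL_index" "coeff4 (log_term i) M N L K \<noteq> 0" by auto
        hence eq: "(0, snd i) = i" using zero[OF i] True by (simp add: prod_eq_iff)
        show "(0, snd i) = i" by (rule eq)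
        show "snd i \<in> ?X" using i unfolding mem_Collect_eq BL eq by blast
        show "coeff4 (log_term (0, snd i)) M N L K = coeff4 (log_term i) M N L K"
          unfolding eq ..
      next
        fix i assume "i \<in> ?X"
        thus "(0, i) \<in> {i \<in> BL_index. coeff4 (log_term i) M N L K \<noteq> 0}"
          using BL by blast
      qed simp
      finally show ?thesis unfolding sum by simp
    qed
  qed
  finally show ?thesis .
qed

lemma formal_ML_eq_log_BL: "formal_ML Phi0 = log_BL"
  unfolding formal_ML_def
proof (rule formal_sum_eqI)
  have V: "formal_V Phi0 m = fls_const (fls_nth log_BL (int m))" for m
    using formal_V_0 formal_V_pos[of m] by (cases "m = 0") simp_all
  have coeff: "coeff4 (var_Q ^ m * formal_V Phi0 m) M n l k =
                 (if M = int m then coeff4 log_BL M n l k else 0)" for m M n l k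
    unfolding V coeff4_def var_Q_def by (simp add: fls_X_power_times_conv_shift)
  show "has_formal_sum (\<lambda>m. var_Q ^ m * formal_V Phi0 m) UNIV log_BL"
    unfolding has_formal_sum_def eventually_finite_subsets_at_top
  proof (intro allI)
    fix M n l k
    show "\<exists>X. finite X \<and> X \<subseteq> UNIV \<and> (\<forall>Y. finite Y \<and> X \<subseteq> Y \<and> Y \<subseteq> UNIV \<longrightarrow>
            coeff4 (\<Sum>m\<in>Y. var_Q ^ m * formal_V Phi0 m) M n l k = coeff4 log_BL M n l k)"
    proof (intro exI[of _ "{nat M}"] conjI allI impI)
      fix Y assume Y: "finite Y \<and> {nat M} \<subseteq> Y \<and> Y \<subseteq> UNIV"
      have "(\<Sum>m\<in>Y. if M = int m then coeff4 log_BL M n l k else 0) =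
              (\<Sum>m\<in>{nat M}. if M = int m then coeff4 log_BL M n l k else 0)"
        using Y by (intro sum.mono_neutral_right) auto
      also have "\<dots> = coeff4 log_BL M n l k"
        using ord_geD(1)[OF ord_ge_log_BL, of M n l k] by (cases "M < 0") (auto simp: in_cone_def)
      finally show "coeff4 (\<Sum>m\<in>Y. var_Q ^ m * formal_V Phi0 m) M n l k = coeff4 log_BL M n l k"
        unfolding coeff4_sum coeff .
    qed auto
  qed
qed

section \<open>The Donaldson--Thomas product\<close>

text \<open>
  A finite subproduct over A may be enlarged by trivial factors until it contains any given finite
  set of factors over I.
\<close>

lemma has_formal_prod_reindex:
  assumes P: "has_formal_prod f I P" and inj: "inj_on \<psi> A" and sub: "\<psi> ` A \<subseteq> I"
    and one: "\<And>i. i \<in> I - \<psi> ` A \<Longrightarrow> f i = 1"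
  shows "has_formal_prod (\<lambda>a. f (\<psi> a)) A P"
  unfolding has_formal_prod_def eventually_finite_subsets_at_top
proof (intro allI)
  fix m n l k
  obtain X where X: "finite X" "X \<subseteq> I"
    "\<And>Y. finite Y \<Longrightarrow> X \<subseteq> Y \<Longrightarrow> Y \<subseteq> I \<Longrightarrow> coeff4 (\<Prod>i\<in>Y. f i) m n l k = coeff4 P m n l k"
    using P[unfolded has_formal_prod_def eventually_finite_subsets_at_top, rule_format, of m n l k] by auto
  show "\<exists>X. finite X \<and> X \<subseteq> A \<and> (\<forall>Y. finite Y \<and> X \<subseteq> Y \<and> Y \<subseteq> A \<longrightarrow>
          coeff4 (\<Prod>a\<in>Y. f (\<psi> a)) m n l k = coeff4 P m n l k)"
  proof (intro exI[of _ "\<psi> -` X \<inter> A"] conjI allI impI)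
    show "finite (\<psi> -` X \<inter> A)" by (rule finite_vimage_IntI[OF X(1) inj])
    fix Y assume Y: "finite Y \<and> \<psi> -` X \<inter> A \<subseteq> Y \<and> Y \<subseteq> A"
    have subset: "\<psi> ` Y \<union> X \<subseteq> I" using X(2) Y sub by blast
    have "(\<Prod>a\<in>Y. f (\<psi> a)) = (\<Prod>i\<in>\<psi> ` Y. f i)"
      using Y inj by (subst prod.reindex) (auto intro: inj_on_subset)
    also have "\<dots> = (\<Prod>i\<in>\<psi> ` Y \<union> X. f i)"
      using Y X(1,2) by (intro prod.mono_neutral_left) (auto intro!: one)
    finally have "coeff4 (\<Prod>a\<in>Y. f (\<psi> a)) m n l k = coeff4 (\<Prod>i\<in>\<psi> ` Y \<union> X. f i) m n l k"
      by simp
    also have "\<dots> = coeff4 P m n l k"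
      using X(1) Y by (intro X(3) subset) auto
    finally show "coeff4 (\<Prod>a\<in>Y. f (\<psi> a)) m n l k = coeff4 P m n l k" .
  qed auto
qed

text \<open>
  Exponents under Q1 = Q/y, Q2 = q/y, Q3 = y.
\<close>

definition banana_index :: "nat \<times> nat \<times> nat \<times> int \<Rightarrow> nat \<times> nat \<times> int \<times> int" where
  "banana_index = (\<lambda>(d1, d2, d3, k). (d1, d2, int d3 - int d1 - int d2, k))"

lemma banana_form_eq_discriminant:
  "banana_form d1 d2 d3 = 4 * int d2 * int d1 - (int d3 - int d1 - int d2)\<^sup>2"
  by (simp add: banana_form_def power2_eq_square algebra_simps)

lemma DT_factor_eq_BL_factor:
  assumes "var_Q = Q1 * Q3" "var_q = Q2 * Q3" "var_y = Q3"
  shows "DT_factor Q1 Q2 Q3 d = BL_factor (banana_index d)"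
proof -
  obtain d1 d2 d3 k where d: "d = (d1, d2, d3, k)" by (cases d)
  have y: "var_y \<noteq> 0" by (simp add: var_y_def)
  have Q: "var_Q ^ d1 = Q1 ^ d1 * var_y ^ d1"
    unfolding assms power_mult_distrib ..
  have q: "var_q ^ d2 = Q2 ^ d2 * var_y ^ d2"
    unfolding assms power_mult_distrib ..
  have "var_Q ^ d1 * var_q ^ d2 * var_y powi (int d3 - int d1 - int d2) =
          Q1 ^ d1 * Q2 ^ d2 * (var_y ^ d1 * var_y ^ d2 * var_y powi (int d3 - int d1 - int d2))"
    unfolding Q q by (simp only: mult_ac)
  also have "var_y ^ d1 * var_y ^ d2 * var_y powi (int d3 - int d1 - int d2) = Q3 ^ d3"
    using power_int_add[of var_y "int d1 + int d2" "int d3 - int d1 - int d2"]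
      power_int_add[of var_y "int d1" "int d2"] y assms(3) by simp
  finally have "Q1 ^ d1 * Q2 ^ d2 * Q3 ^ d3 =
      var_Q ^ d1 * var_q ^ d2 * var_y powi (int d3 - int d1 - int d2)" by simp
  thus ?thesis
    by (simp only: DT_factor_def BL_factor_def banana_index_def d prod.case banana_form_eq_discriminant)
qed

lemma BL_factor_outside_banana:
  assumes "i \<in> BL_index - banana_index ` DT_index"
  shows "BL_factor i = 1"
proof -
  obtain m n l k where i: "i = (m, n, l, k)" by (cases i)
  have "l + int m + int n < 0"
  proof (rule ccontr)
    assume "\<not> l + int m + int n < 0"
    hence "i = banana_index (m, n, nat (l + int m + int n), k)"
      by (simp add: banana_index_def i)
    moreover have "(m, n, nat (l + int m + int n), k) \<in> DT_index"
      using assms by (auto simp: i DT_index_def BL_index_def)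
    ultimately show False using assms by blast
  qed
  moreover have "m > 0 \<or> n > 0"
    using assms calculation by (auto simp: i BL_index_def)
  ultimately have "jacobi_coeff Phi0 (4 * int n * int m - l\<^sup>2) k = 0"
    using Phi0_support_in_cone(2)[of n m l k] by linarith
  thus ?thesis by (simp add: BL_factor_def i)
qed

theorem proposition7p2p1:
  fixes Q1 Q2 Q3 :: series4
  assumes "var_Q = Q1 * Q3" and "var_q = Q2 * Q3" and "var_y = Q3"
  shows "formally_multipliable (DT_factor Q1 Q2 Q3) DT_index \<and>
         formally_multipliable BL_factor BL_index \<and>
         Z_DT_banana Q1 Q2 Q3 = formal_BL 12 Phi0 \<and>
         formal_BL 12 Phi0 = formal_prod BL_factor BL_index"
proof -
  have BL: "formal_BL 12 Phi0 = formal_exp (of_nat 12 * log_BL)"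
    unfolding formal_BL_def formal_ML_eq_log_BL ..
  have prod: "has_formal_prod BL_factor BL_index (formal_BL 12 Phi0)"
    unfolding BL by (rule has_formal_prod_BL_factor)
  have "has_formal_prod (\<lambda>d. BL_factor (banana_index d)) DT_index (formal_BL 12 Phi0)"
  proof (rule has_formal_prod_reindex[OF prod])
    show "inj_on banana_index DT_index"
      by (auto simp: inj_on_def banana_index_def)
    show "banana_index ` DT_index \<subseteq> BL_index"
      by (auto simp: banana_index_def DT_index_def BL_index_def)
  qed (rule BL_factor_outside_banana)
  hence DT: "has_formal_prod (DT_factor Q1 Q2 Q3) DT_index (formal_BL 12 Phi0)"
    unfolding DT_factor_eq_BL_factor[OF assms, abs_def] .
  show ?thesis
    using prod DT formal_prod_eqI[OF prod] formal_prod_eqI[OF DT]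
    by (auto simp: formally_multipliable_def Z_DT_banana_def)
qed

end
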